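(* Algorithm ED for $P_5$-free graphs (described in the context) is correct and runs in linear time $O(n+m)$: given a prime $P_5$-free graph $G$ with $n$ vertices and $m$ edges, it correctly decides whether $G$ has an efficient dominating set and, if so, outputs one.
   Context: All graphs are finite, simple and undirected; $N(v)$ is the neighborhood of $v$, $N[v]=N(v)\cup\{v\}$, $\deg(v)$ is the degree and $\delta(G)$ the minimum degree. A vertex dominates itself and its neighbors. A set $D \subseteq V(G)$ is an efficient dominating set (e.d.) if every vertex is dominated by exactly one vertex of $D$. $P_5$ is the chordless path on five vertices; $G$ is $P_5$-free if it has no induced $P_5$. A set $H$ of at least two vertices is homogeneous if $H\ne V(G)$ and every vertex outside $H$ is adjacent to all or to none of $H$; $G$ is prime if it has no homogeneous set. A thin spider is a split graph with vertex partition into a clique $C$ and an independent set $I$ such that each vertex of $C$ has exactly one neighbor in $I$ and vice versa. Algorithm ED for $P_5$-free graphs, on a prime graph $G=(V,E)$: (0) compute $\deg(v)$ for all $v$. (1) Check whether $G$ is a thin spider with $D$ the set of all degree-1 vertices; if yes, output $D$ as the e.d. and stop. (2) Otherwise choose a vertex $d$ of minimum degree $\delta(G)$ and check whether $N(d)$ is a clique; if not, stop (no e.d. or $G$ not $P_5$-free). Otherwise choose a vertex $d'$ of minimum degree in $G$ among the vertices of $V\setminus N[d]$ and check whether $N(d')$ is a clique; if not, stop (no e.d. or $G$ not $P_5$-free). (3) Check whether $\{d,d'\}$ is an e.d. of $G$; if yes, output it, otherwise report that $G$ has no e.d. *)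

theory Defs
  imports Main
begin

section \<open>Graphs\<close>

definition fin_simple_graph :: "'a set \<Rightarrow> 'a set set \<Rightarrow> bool" where
  "fin_simple_graph V E \<longleftrightarrow> finite V \<and> (\<forall>e\<in>E. e \<subseteq> V \<and> card e = 2)"

definition nbhd :: "'a set set \<Rightarrow> 'a \<Rightarrow> 'a set" where
  "nbhd E v = {u. {u, v} \<in> E}"

definition closed_nbhd :: "'a set set \<Rightarrow> 'a \<Rightarrow> 'a set" where
  "closed_nbhd E v = insert v (nbhd E v)"

definition deg :: "'a set set \<Rightarrow> 'a \<Rightarrow> nat" where
  "deg E v = card (nbhd E v)"

definition clique :: "'a set set \<Rightarrow> 'a set \<Rightarrow> bool" where
  "clique E S \<longleftrightarrow> (\<forall>u\<in>S. \<forall>v\<in>S. u \<noteq> v \<longrightarrow> {u, v} \<in> E)"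

definition independent_set :: "'a set set \<Rightarrow> 'a set \<Rightarrow> bool" where
  "independent_set E S \<longleftrightarrow> (\<forall>u\<in>S. \<forall>v\<in>S. {u, v} \<notin> E)"

definition efficient_dominating_set :: "'a set \<Rightarrow> 'a set set \<Rightarrow> 'a set \<Rightarrow> bool" where
  "efficient_dominating_set V E D \<longleftrightarrow> D \<subseteq> V \<and> (\<forall>v\<in>V. \<exists>!d. d \<in> D \<and> v \<in> closed_nbhd E d)"

definition P5_free :: "'a set \<Rightarrow> 'a set set \<Rightarrow> bool" where
  "P5_free V E \<longleftrightarrow>
     \<not> (\<exists>p :: nat \<Rightarrow> 'a. p ` {..<5} \<subseteq> V \<and> inj_on p {..<5} \<and>
          (\<forall>i<5. \<forall>j<5. {p i, p j} \<in> E \<longleftrightarrow> (j = Suc i \<or> i = Suc j)))"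

definition homogeneous :: "'a set \<Rightarrow> 'a set set \<Rightarrow> 'a set \<Rightarrow> bool" where
  "homogeneous V E H \<longleftrightarrow> H \<subseteq> V \<and> 2 \<le> card H \<and> H \<noteq> V \<and>
     (\<forall>x\<in>V - H. (\<forall>h\<in>H. {x, h} \<in> E) \<or> (\<forall>h\<in>H. {x, h} \<notin> E))"

definition prime_graph :: "'a set \<Rightarrow> 'a set set \<Rightarrow> bool" where
  "prime_graph V E \<longleftrightarrow> \<not> (\<exists>H. homogeneous V E H)"

definition thin_spider_partition :: "'a set \<Rightarrow> 'a set set \<Rightarrow> 'a set \<Rightarrow> 'a set \<Rightarrow> bool" where
  "thin_spider_partition V E C I \<longleftrightarrow>
     C \<union> I = V \<and> C \<inter> I = {} \<and> clique E C \<and> independent_set E I \<and>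
     (\<forall>c\<in>C. \<exists>!i. i \<in> I \<and> {c, i} \<in> E) \<and> (\<forall>i\<in>I. \<exists>!c. c \<in> C \<and> {c, i} \<in> E)"


section \<open>The algorithm, with arbitrary choices of the minimum degree vertices\<close>

definition leaves :: "'a set \<Rightarrow> 'a set set \<Rightarrow> 'a set" where
  "leaves V E = {v \<in> V. deg E v = 1}"

text \<open>The set of leaves has to be the independent part of the spider. This matters only for the
  complete graph on two vertices, where both vertices are leaves.\<close>

definition is_leaf_spider :: "'a set \<Rightarrow> 'a set set \<Rightarrow> bool" where
  "is_leaf_spider V E \<longleftrightarrow> (\<exists>C. thin_spider_partition V E C (leaves V E))"

definition min_degree_in :: "'a set set \<Rightarrow> 'a set \<Rightarrow> 'a \<Rightarrow> bool" where
  "min_degree_in E S d \<longleftrightarrow> is_arg_min (deg E) (\<lambda>v. v \<in> S) d"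

text \<open>\<open>Stop\<close> is the answer \<open>no e.d. or not P5-free\<close> of the two clique tests, \<open>No_ED\<close> the negative
  answer of the final test.\<close>

datatype 'a outcome = Output "'a set" | Stop | No_ED

text \<open>\<open>ED V E r\<close>: some run of the algorithm on \<open>(V, E)\<close> ends with \<open>r\<close>. The rule \<open>universal\<close> covers
  the runs in which there is no candidate for the second vertex, that is, in which \<open>d\<close> dominates all
  vertices. Among prime graphs this happens only if there are at most two vertices.\<close>

inductive ED :: "'a set \<Rightarrow> 'a set set \<Rightarrow> 'a outcome \<Rightarrow> bool" for V E where
  spider: "is_leaf_spider V E \<Longrightarrow> ED V E (Output (leaves V E))"
| stop1: "\<lbrakk>\<not> is_leaf_spider V E; min_degree_in E V d; \<not> clique E (nbhd E d)\<rbrakk> \<Longrightarrow> ED V E Stop"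
| universal: "\<lbrakk>\<not> is_leaf_spider V E; min_degree_in E V d; clique E (nbhd E d);
    V - closed_nbhd E d = {}\<rbrakk> \<Longrightarrow> ED V E (Output {d})"
| stop2: "\<lbrakk>\<not> is_leaf_spider V E; min_degree_in E V d; clique E (nbhd E d);
    min_degree_in E (V - closed_nbhd E d) d'; \<not> clique E (nbhd E d')\<rbrakk> \<Longrightarrow> ED V E Stop"
| found: "\<lbrakk>\<not> is_leaf_spider V E; min_degree_in E V d; clique E (nbhd E d);
    min_degree_in E (V - closed_nbhd E d) d'; clique E (nbhd E d');
    efficient_dominating_set V E {d, d'}\<rbrakk> \<Longrightarrow> ED V E (Output {d, d'})"
| not_found: "\<lbrakk>\<not> is_leaf_spider V E; min_degree_in E V d; clique E (nbhd E d);
    min_degree_in E (V - closed_nbhd E d) d'; clique E (nbhd E d');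
    \<not> efficient_dominating_set V E {d, d'}\<rbrakk> \<Longrightarrow> ED V E No_ED"

definition correct_outcome :: "'a set \<Rightarrow> 'a set set \<Rightarrow> 'a outcome \<Rightarrow> bool" where
  "correct_outcome V E r \<longleftrightarrow> (case r of
       Output D \<Rightarrow> efficient_dominating_set V E D
     | _ \<Rightarrow> \<not> (\<exists>D. efficient_dominating_set V E D))"


section \<open>A random access machine with bounded loops\<close>

text \<open>Running time is counted in the uniform cost model: every constant, register access, array
  access, arithmetic operation, comparison, Boolean operation, assignment, branching and loop
  iteration costs one step. The only arithmetic is addition and (truncated) subtraction.\<close>

datatype aexp = Const nat | Reg string | Read string aexp | Add aexp aexp | Sub aexp aexp

datatype bexp = Eq aexp aexp | Less aexp aexp | Neg bexp | And bexp bexp | Or bexp bexp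

datatype com =
    Assign string aexp
  | Write string aexp aexp
  | Seq com com (infixr ";;" 60)
  | Cond bexp com com
  | For string aexp aexp com
  | Skip

record state =
  reg :: "string \<Rightarrow> nat"
  arr :: "string \<Rightarrow> nat \<Rightarrow> nat"

primrec aval :: "aexp \<Rightarrow> state \<Rightarrow> nat" where
  "aval (Const k) s = k"
| "aval (Reg x) s = reg s x"
| "aval (Read x a) s = arr s x (aval a s)"
| "aval (Add a b) s = aval a s + aval b s"
| "aval (Sub a b) s = aval a s - aval b s"

primrec acost :: "aexp \<Rightarrow> nat" where
  "acost (Const k) = 1"
| "acost (Reg x) = 1"
| "acost (Read x a) = acost a + 1"
| "acost (Add a b) = acost a + acost b + 1"
| "acost (Sub a b) = acost a + acost b + 1"

primrec bval :: "bexp \<Rightarrow> state \<Rightarrow> bool" where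
  "bval (Eq a b) s = (aval a s = aval b s)"
| "bval (Less a b) s = (aval a s < aval b s)"
| "bval (Neg b) s = (\<not> bval b s)"
| "bval (And b c) s = (bval b s \<and> bval c s)"
| "bval (Or b c) s = (bval b s \<or> bval c s)"

primrec bcost :: "bexp \<Rightarrow> nat" where
  "bcost (Eq a b) = acost a + acost b + 1"
| "bcost (Less a b) = acost a + acost b + 1"
| "bcost (Neg b) = bcost b + 1"
| "bcost (And b c) = bcost b + bcost c + 1"
| "bcost (Or b c) = bcost b + bcost c + 1"

text \<open>\<open>exec c s\<close> is the final state together with the number of steps. \<open>For x a b c\<close> executes \<open>c\<close> for
  \<open>x = a, ..., b - 1\<close>; the bounds are evaluated once, before the loop.\<close>

primrec exec :: "com \<Rightarrow> state \<Rightarrow> state \<times> nat" where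
  "exec (Assign x a) s = (s\<lparr>reg := (reg s)(x := aval a s)\<rparr>, acost a + 1)"
| "exec (Write x a b) s =
     (s\<lparr>arr := (arr s)(x := (arr s x)(aval a s := aval b s))\<rparr>, acost a + acost b + 1)"
| "exec (c ;; d) s =
     (let (s', t) = exec c s; (s'', t') = exec d s' in (s'', t + t'))"
| "exec (Cond b c d) s =
     (let (s', t) = (if bval b s then exec c s else exec d s) in (s', bcost b + t + 1))"
| "exec (For x a b c) s =
     fold (\<lambda>i (s, t). let (s', t') = exec c (s\<lparr>reg := (reg s)(x := i)\<rparr>) in (s', t + t' + 1))
       [aval a s..<aval b s] (s, acost a + acost b + 1)"
| "exec Skip s = (s, 1)"


section \<open>The algorithm as a program\<close>

text \<open>The input graph has the vertices \<open>0, ..., n - 1\<close> and is given by adjacency lists, in arbitrary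
  order, stored one after the other in the array \<open>adj\<close>: the neighbours of \<open>v\<close> are found at the
  positions \<open>off[v], ..., off[v + 1] - 1\<close>. All other registers and arrays have arbitrary initial
  contents.\<close>

definition adjacency_lists :: "nat \<Rightarrow> nat set set \<Rightarrow> state \<Rightarrow> bool" where
  "adjacency_lists n E s \<longleftrightarrow> reg s ''n'' = n \<and> arr s ''off'' 0 = 0 \<and>
     (\<forall>v<n. arr s ''off'' v \<le> arr s ''off'' (v + 1) \<and>
        bij_betw (arr s ''adj'') {arr s ''off'' v..<arr s ''off'' (v + 1)} (nbhd E v))"

definition for_vertices :: "string \<Rightarrow> com \<Rightarrow> com" where
  "for_vertices v c = For v (Const 0) (Reg ''n'') c"

definition for_positions :: "string \<Rightarrow> string \<Rightarrow> com \<Rightarrow> com" where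
  "for_positions j v c =
     For j (Read ''off'' (Reg v)) (Read ''off'' (Add (Reg v) (Const 1))) c"

definition increment :: "string \<Rightarrow> com" where
  "increment x = Assign x (Add (Reg x) (Const 1))"

definition compute_degrees :: com where
  "compute_degrees = for_vertices ''v'' (Write ''deg'' (Reg ''v'')
     (Sub (Read ''off'' (Add (Reg ''v'') (Const 1))) (Read ''off'' (Reg ''v''))))"

text \<open>With \<open>I\<close> the set of leaves, \<open>C\<close> its complement and \<open>k\<close> the number of neighbours of \<open>v\<close> in \<open>I\<close>:
  \<open>k\<close> must be \<open>0\<close> for \<open>v\<close> in \<open>I\<close>, whereas for \<open>v\<close> in \<open>C\<close> it must be \<open>1\<close> and \<open>v\<close> must have \<open>|C| - 1\<close>
  neighbours in \<open>C\<close>, that is, degree \<open>|C|\<close>.\<close>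

definition test_spider :: com where
  "test_spider =
     Assign ''csize'' (Const 0) ;;
     for_vertices ''v'' (Cond (Eq (Read ''deg'' (Reg ''v'')) (Const 1)) Skip (increment ''csize'')) ;;
     Assign ''spider'' (Const 1) ;;
     for_vertices ''v'' (
       Assign ''k'' (Const 0) ;;
       for_positions ''j'' ''v''
         (Cond (Eq (Read ''deg'' (Read ''adj'' (Reg ''j''))) (Const 1)) (increment ''k'') Skip) ;;
       Cond (Eq (Read ''deg'' (Reg ''v'')) (Const 1))
         (Cond (Eq (Reg ''k'') (Const 0)) Skip (Assign ''spider'' (Const 0)))
         (Cond (And (Eq (Reg ''k'') (Const 1)) (Eq (Read ''deg'' (Reg ''v'')) (Reg ''csize'')))
            Skip (Assign ''spider'' (Const 0))))"

text \<open>Marks the neighbours of the vertex in register \<open>x\<close> and sets \<open>q\<close> to \<open>1\<close> if they form a clique,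
  that is, if each of them has \<open>deg x - 1\<close> marked neighbours.\<close>

definition test_clique :: "string \<Rightarrow> com" where
  "test_clique x =
     for_vertices ''v'' (Write ''mark'' (Reg ''v'') (Const 0)) ;;
     for_positions ''i'' x (Write ''mark'' (Read ''adj'' (Reg ''i'')) (Const 1)) ;;
     Assign ''q'' (Const 1) ;;
     for_positions ''i'' x (
       Assign ''u'' (Read ''adj'' (Reg ''i'')) ;;
       Assign ''k'' (Const 0) ;;
       for_positions ''j'' ''u''
         (Cond (Eq (Read ''mark'' (Read ''adj'' (Reg ''j''))) (Const 1)) (increment ''k'') Skip) ;;
       Cond (Eq (Add (Reg ''k'') (Const 1)) (Read ''deg'' (Reg x))) Skip (Assign ''q'' (Const 0)))"

definition choose_first :: com where
  "choose_first =
     Assign ''d'' (Const 0) ;;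
     for_vertices ''v'' (Cond (Less (Read ''deg'' (Reg ''v'')) (Read ''deg'' (Reg ''d'')))
       (Assign ''d'' (Reg ''v'')) Skip)"

text \<open>Relies on the marks left by \<open>test_clique\<close> for the first vertex; \<open>has\<close> tells whether there is a
  candidate at all.\<close>

definition choose_second :: com where
  "choose_second =
     Assign ''has'' (Const 0) ;;
     Assign ''e'' (Const 0) ;;
     for_vertices ''v'' (
       Cond (Or (Eq (Reg ''v'') (Reg ''d'')) (Eq (Read ''mark'' (Reg ''v'')) (Const 1))) Skip
         (Cond (Or (Eq (Reg ''has'') (Const 0))
                 (Less (Read ''deg'' (Reg ''v'')) (Read ''deg'' (Reg ''e''))))
            (Assign ''e'' (Reg ''v'') ;; Assign ''has'' (Const 1))
            Skip))"

definition test_pair :: com where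
  "test_pair =
     Assign ''ok'' (Const 1) ;;
     for_vertices ''v'' (
       Assign ''k'' (Const 0) ;;
       Cond (Or (Eq (Reg ''v'') (Reg ''d'')) (Eq (Reg ''v'') (Reg ''e''))) (increment ''k'') Skip ;;
       for_positions ''j'' ''v''
         (Cond (Or (Eq (Read ''adj'' (Reg ''j'')) (Reg ''d''))
                 (Eq (Read ''adj'' (Reg ''j'')) (Reg ''e'')))
            (increment ''k'') Skip) ;;
       Cond (Eq (Reg ''k'') (Const 1)) Skip (Assign ''ok'' (Const 0)))"

text \<open>Outputs the set of all \<open>v\<close> with property \<open>b\<close>, as a characteristic vector.\<close>

definition output_set :: "bexp \<Rightarrow> com" where
  "output_set b =
     Assign ''status'' (Const 0) ;;
     for_vertices ''v''
       (Cond b (Write ''out'' (Reg ''v'') (Const 1)) (Write ''out'' (Reg ''v'') (Const 0)))"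

definition ED_program :: com where
  "ED_program =
     compute_degrees ;;
     test_spider ;;
     Cond (Eq (Reg ''spider'') (Const 1))
       (output_set (Eq (Read ''deg'' (Reg ''v'')) (Const 1)))
       (choose_first ;;
        test_clique ''d'' ;;
        Cond (Eq (Reg ''q'') (Const 0))
          (Assign ''status'' (Const 1))
          (choose_second ;;
           Cond (Eq (Reg ''has'') (Const 0))
             (output_set (Eq (Reg ''v'') (Reg ''d'')))
             (test_clique ''e'' ;;
              Cond (Eq (Reg ''q'') (Const 0))
                (Assign ''status'' (Const 1))
                (test_pair ;;
                 Cond (Eq (Reg ''ok'') (Const 1))
                   (output_set (Or (Eq (Reg ''v'') (Reg ''d'')) (Eq (Reg ''v'') (Reg ''e''))))
                   (Assign ''status'' (Const 2))))))"

definition program_outcome :: "nat \<Rightarrow> state \<Rightarrow> nat outcome" where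
  "program_outcome n s =
     (if reg s ''status'' = 0 then Output {v. v < n \<and> arr s ''out'' v = 1}
      else if reg s ''status'' = 1 then Stop else No_ED)"

end

theory Submission
  imports Defs
begin

text \<open>Let \<open>D\<close> be an efficient dominating set of a prime \<open>P\<^sub>5\<close>-free graph with at least three vertices.
  A component of the complement of the graph induced by \<open>N(i)\<close>, where \<open>i \<in> D\<close>, is homogeneous, so
  \<open>N(i)\<close> is a clique; by primality \<open>i\<close> has strictly smaller degree than its neighbours. Hence minimum
  degree vertices belong to \<open>D\<close>. If \<open>|D| = 2\<close>, the two chosen vertices therefore form \<open>D\<close>; if
  \<open>|D| \<ge> 3\<close>, the exclusion of induced \<open>P\<^sub>5\<close>s makes the neighbourhoods of the members of \<open>D\<close> mutually
  homogeneous, hence singletons, and the graph is a thin spider. For the program, every nested loop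
  over positions costs a multiple of a sum of degrees, which is at most twice the number of edges.\<close>

section \<open>Efficient dominating sets of prime P5-free graphs\<close>

text \<open>Negative answers are justified by contraposition: if an e.d. \<open>D\<close> existed,
  the chosen vertex \<open>d\<close> would lie in \<open>D\<close>, since otherwise its dominator
  would have smaller degree, and so it would pass the clique test. The same argument applies to
  \<open>d'\<close>: its dominator is not \<open>d\<close>, and it is not a neighbour of
  \<open>d\<close> because \<open>D\<close> is independent, so it competes with \<open>d'\<close>
  for the minimum. The structural lemmas need three vertices, because a pair of twins that is all of
  \<open>V\<close> is not homogeneous; graphs with at most two vertices are treated apart. The
  choice among several vertices of minimum degree is left open. Correctness is therefore proved for
  the relation \<open>ED\<close>, and the program is only shown to perform one of its runs. Without
  an adjacency matrix, single adjacencies cannot be tested in constant time. The tests count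
  instead: a set of neighbours contained in a known set exhausts it as soon as the cardinalities
  agree, and counting needs only one pass over the adjacency lists.\<close>

locale simple_graph =
  fixes V :: "'a set" and E :: "'a set set"
  assumes graph: "fin_simple_graph V E"
begin

definition adjacent :: "'a \<Rightarrow> 'a \<Rightarrow> bool" where
  "adjacent u v \<longleftrightarrow> {u, v} \<in> E"

lemma finite_V: "finite V"
  using graph by (simp add: fin_simple_graph_def)

lemma adjacent_sym: "adjacent u v \<longleftrightarrow> adjacent v u"
  by (simp add: adjacent_def insert_commute)

lemma adjacent_irrefl [simp]: "\<not> adjacent u u"
  using graph by (force simp: adjacent_def fin_simple_graph_def)

lemma adjacent_in_V: assumes "adjacent u v" shows "u \<in> V" "v \<in> V"
  using assms graph by (auto simp: adjacent_def fin_simple_graph_def)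

lemma nbhd_iff: "u \<in> nbhd E v \<longleftrightarrow> adjacent v u"
  by (simp add: nbhd_def adjacent_def insert_commute)

lemma closed_nbhd_iff: "u \<in> closed_nbhd E v \<longleftrightarrow> u = v \<or> adjacent v u"
  by (simp add: closed_nbhd_def nbhd_iff)

lemma nbhd_subset: "nbhd E v \<subseteq> V"
  by (auto simp: nbhd_iff adjacent_in_V)

lemma finite_nbhd: "finite (nbhd E v)"
  using finite_subset[OF nbhd_subset finite_V] .

text \<open>A vertex of \<open>C\<close> is dominated by its only leaf neighbour, and a leaf only by
  itself because the leaves are independent.\<close>

lemma leaf_spider_efficient:
  assumes "is_leaf_spider V E"
  shows "efficient_dominating_set V E (leaves V E)"
proof -
  obtain C where C: "thin_spider_partition V E C (leaves V E)"
    using assms by (auto simp: is_leaf_spider_def)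
  show ?thesis
    unfolding efficient_dominating_set_def
  proof (intro conjI ballI)
    show "leaves V E \<subseteq> V" by (auto simp: leaves_def)
    fix v assume "v \<in> V"
    then consider "v \<in> C" "v \<notin> leaves V E" | "v \<in> leaves V E"
      using C by (auto simp: thin_spider_partition_def)
    then show "\<exists>!d. d \<in> leaves V E \<and> v \<in> closed_nbhd E d"
    proof cases
      case 1
      then show ?thesis
        using C by (auto simp: thin_spider_partition_def closed_nbhd_def nbhd_def)
    next
      case 2
      then have "\<not> adjacent d v" if "d \<in> leaves V E" for d
        using that C by (auto simp: thin_spider_partition_def independent_set_def adjacent_def)
      then show ?thesis
        using 2 by (auto simp: closed_nbhd_iff)
    qed
  qed
qed

text \<open>Correctness of all runs would be vacuous for a stuck algorithm; finite nonempty
  candidate sets have minima, and \<open>universal\<close> takes over when the second candidate set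
  is empty.\<close>

lemma ED_total: "\<exists>r. ED V E r"
proof (cases "is_leaf_spider V E")
  case True
  then show ?thesis using ED.spider by blast
next
  case False
  have arg_min: "\<exists>d. min_degree_in E S d" if "S \<subseteq> V" "S \<noteq> {}" for S
    unfolding min_degree_in_def
    by (rule ex_is_arg_min_if_finite[OF finite_subset[OF that(1) finite_V] that(2)])
  \<comment> \<open>On the empty graph, \<open>C = {}\<close> and the empty set of leaves form a
    spider partition, so the spider test would have succeeded.\<close>
  have "V \<noteq> {}"
    using False
    by (auto simp: is_leaf_spider_def thin_spider_partition_def leaves_def clique_def
        independent_set_def)
  then obtain d where d: "min_degree_in E V d"
    using arg_min by blast
  show ?thesis
  proof (cases "clique E (nbhd E d) \<and> V - closed_nbhd E d \<noteq> {}")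
    case True
    then obtain d' where "min_degree_in E (V - closed_nbhd E d) d'"
      using arg_min[of "V - closed_nbhd E d"] by blast
    then show ?thesis
      using False d True ED.stop2 ED.found ED.not_found by metis
  next
    case False': False
    then show ?thesis
      using False d ED.stop1 ED.universal by metis
  qed
qed

end

section \<open>Primality and P5-freeness in the form in which they are applied\<close>

locale prime_P5_free_graph = simple_graph +
  assumes prime: "prime_graph V E" and P5_free: "P5_free V E" and large: "3 \<le> card V"
begin

text \<open>Primality in working form: a proper set that no outside vertex distinguishes has at most
  one element. Contradictions arise by applying it to two vertices known to differ.\<close>

lemma homogeneous_trivial:
  assumes "H \<subseteq> V" "H \<noteq> V" "a \<in> H" "b \<in> H"
    and "\<And>x. x \<in> V - H \<Longrightarrow> (\<forall>h\<in>H. adjacent x h) \<or> (\<forall>h\<in>H. \<not> adjacent x h)"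
  shows "a = b"
proof (rule ccontr)
  assume "a \<noteq> b"
  then have "card {a, b} \<le> card H"
    using assms finite_V by (intro card_mono) (auto intro: finite_subset)
  then have "2 \<le> card H" using \<open>a \<noteq> b\<close> by simp
  then have "homogeneous V E H"
    using assms by (simp add: homogeneous_def adjacent_def)
  then show False
    using prime by (auto simp: prime_graph_def)
qed

text \<open>Distinctness of the five vertices follows from the pattern of edges and non-edges, so
  users supply only adjacencies.\<close>

lemma no_induced_P5:
  assumes "adjacent a b" "adjacent b c" "adjacent c d" "adjacent d e"
    and "\<not> adjacent a c" "\<not> adjacent a d" "\<not> adjacent a e"
    and "\<not> adjacent b d" "\<not> adjacent b e" "\<not> adjacent c e"
  shows False
proof -
  define p where "p = (\<lambda>i. [a, b, c, d, e] ! i)"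
  have five: "{..<5} = {0, 1, 2, 3, 4::nat}" by auto
  have p: "p 0 = a" "p (Suc 0) = b" "p 2 = c" "p 3 = d" "p 4 = e"
    by (simp_all add: p_def eval_nat_numeral)
  have neq: "a \<noteq> b" "a \<noteq> c" "a \<noteq> d" "a \<noteq> e" "b \<noteq> c" "b \<noteq> d" "b \<noteq> e" "c \<noteq> d" "c \<noteq> e" "d \<noteq> e"
    using assms adjacent_sym adjacent_irrefl by metis+
  have "p ` {..<5} \<subseteq> V"
    using assms adjacent_in_V by (auto simp: five p)
  moreover have "inj_on p {..<5}"
    using neq by (auto simp: five p)
  moreover have "\<forall>i\<in>{..<5}. \<forall>j\<in>{..<5}. adjacent (p i) (p j) \<longleftrightarrow> j = Suc i \<or> i = Suc j"
    unfolding five using assms adjacent_sym by (simp add: p)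
  ultimately show False
    using P5_free by (auto simp: P5_free_def adjacent_def)
qed

text \<open>If \<open>H\<close> were a proper union of components, both \<open>H\<close> and its
  complement would be undistinguished from outside, hence singletons, leaving only two
  vertices.\<close>

lemma connected:
  assumes "H \<subseteq> V" "H \<noteq> {}" "\<And>x y. x \<in> H \<Longrightarrow> adjacent x y \<Longrightarrow> y \<in> H"
  shows "H = V"
proof (rule ccontr)
  assume "H \<noteq> V"
  obtain a where a: "a \<in> H" using assms by auto
  obtain b where b: "b \<in> V" "b \<notin> H" using assms \<open>H \<noteq> V\<close> by auto
  have "H \<subseteq> {a}"
    using homogeneous_trivial[of H _ a] assms \<open>H \<noteq> V\<close> a adjacent_sym by blast
  moreover have "V - H \<subseteq> {b}"
    using homogeneous_trivial[of "V - H" _ b] assms a b adjacent_sym by blast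
  ultimately have "V \<subseteq> {a, b}" by auto
  then have "card V \<le> card {a, b}" by (rule card_mono[rotated]) simp
  also have "\<dots> \<le> 2" by (simp add: card_insert_if)
  finally show False using large by simp
qed

end

section \<open>Structure imposed by an efficient dominating set\<close>

locale prime_P5_free_graph_ed = prime_P5_free_graph +
  fixes D :: "'a set"
  assumes ed: "efficient_dominating_set V E D"
begin

lemma D_in_V: "i \<in> D \<Longrightarrow> i \<in> V"
  using ed by (auto simp: efficient_dominating_set_def)

lemma dominated: "v \<in> V \<Longrightarrow> v \<in> D \<or> (\<exists>i\<in>D. adjacent i v)"
  using ed by (auto simp: efficient_dominating_set_def closed_nbhd_iff)

lemma D_independent: "i \<in> D \<Longrightarrow> j \<in> D \<Longrightarrow> \<not> adjacent i j"
  using ed D_in_V adjacent_irrefl unfolding efficient_dominating_set_def closed_nbhd_iff by metis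

lemma dominator_unique:
  "i \<in> D \<Longrightarrow> j \<in> D \<Longrightarrow> adjacent i v \<Longrightarrow> adjacent j v \<Longrightarrow> i = j"
  using ed adjacent_in_V unfolding efficient_dominating_set_def closed_nbhd_iff by metis

text \<open>Otherwise \<open>z, i, x, y, j\<close> is an induced path.\<close>

lemma cross_edge_dominates:
  assumes "i \<in> D" "j \<in> D" "i \<noteq> j" "adjacent i x" "adjacent j y" "adjacent x y" "adjacent i z"
  shows "adjacent z x \<or> adjacent z y"
  using no_induced_P5[of z i x y j] assms D_independent dominator_unique adjacent_sym by metis

text \<open>A connected component \<open>Q\<close> of the complement of the graph induced by \<open>N(i)\<close> is homogeneous,
  since by the previous lemma a vertex outside \<open>N[i]\<close> with a neighbour in \<open>Q\<close> is adjacent to all of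
  \<open>Q\<close>.\<close>

lemma simplicial:
  assumes i: "i \<in> D" and "adjacent i a" "adjacent i b" "a \<noteq> b"
  shows "adjacent a b"
proof (rule ccontr)
  assume nab: "\<not> adjacent a b"
  define R where "R = {(u, v). adjacent i u \<and> adjacent i v \<and> \<not> adjacent u v}"
  define Q where "Q = {u. (a, u) \<in> R\<^sup>*}"
  have "sym R" by (auto simp: R_def sym_def adjacent_sym)
  then have symR: "(u, v) \<in> R\<^sup>* \<Longrightarrow> (v, u) \<in> R\<^sup>*" for u v
    using sym_rtrancl symD by metis
  have Qi: "adjacent i u" if "u \<in> Q" for u
  proof -
    have "(a, u) \<in> R\<^sup>*" using that by (simp add: Q_def)
    then show ?thesis by cases (use assms in \<open>auto simp: R_def\<close>)
  qed
  have "a = b"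
  proof (rule homogeneous_trivial[of Q])
    show "Q \<subseteq> V" using Qi adjacent_in_V by blast
    show "Q \<noteq> V" using Qi D_in_V[OF i] adjacent_irrefl by metis
    show "a \<in> Q" by (simp add: Q_def)
    show "b \<in> Q" using assms nab by (auto simp: Q_def R_def)
    fix x assume x: "x \<in> V - Q"
    show "(\<forall>h\<in>Q. adjacent x h) \<or> (\<forall>h\<in>Q. \<not> adjacent x h)"
    proof (cases "adjacent i x")
      case True
      have "adjacent x h" if "h \<in> Q" for h
      proof (rule ccontr)
        assume "\<not> adjacent x h"
        then have "(h, x) \<in> R" using True Qi[OF that] by (auto simp: R_def adjacent_sym)
        then show False using that x by (auto simp: Q_def intro: rtrancl_into_rtrancl)
      qed
      then show ?thesis by blast
    next
      case False
      show ?thesis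
      proof (cases "x \<in> D")
        \<comment> \<open>Either \<open>x\<close> is \<open>i\<close>, adjacent to all of
          \<open>Q\<close>, or it is another dominator, adjacent to nothing in
          \<open>N(i)\<close>.\<close>
        case True
        then show ?thesis
          using Qi i adjacent_sym dominator_unique by metis
      next
        case nD: False
        then obtain j where j: "j \<in> D" "adjacent j x" "i \<noteq> j"
          using x False dominated by blast
        have "adjacent x w" if "h \<in> Q" "adjacent x h" "w \<in> Q" for h w
        proof -
          have "(h, w) \<in> R\<^sup>*"
            using that symR unfolding Q_def by (blast intro: rtrancl_trans)
          then show ?thesis
          proof induction
            case base
            show ?case by fact
          next
            \<comment> \<open>Adjacency to \<open>x\<close> spreads along non-edges of
              \<open>N(i)\<close>: \<open>u\<close> is adjacent to \<open>x\<close> but not to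
              \<open>v\<close>, so \<open>cross_edge_dominates\<close> leaves only that
              \<open>v\<close> is adjacent to \<open>x\<close>.\<close>
            case (step u v)
            then show ?case
              using cross_edge_dominates[of i j u x v] i j adjacent_sym by (auto simp: R_def)
          qed
        qed
        then show ?thesis by blast
      qed
    qed
  qed
  then show False using assms by simp
qed

text \<open>Since \<open>N(i)\<close> is a clique, \<open>N[i]\<close> is contained in
  \<open>N[x]\<close>. Equality would make \<open>i\<close> and \<open>x\<close> twins, a
  homogeneous pair once there are three vertices.\<close>

lemma deg_less:
  assumes i: "i \<in> D" and x: "adjacent i x"
  shows "deg E i < deg E x"
proof -
  have sub: "nbhd E i - {x} \<subseteq> nbhd E x - {i}"
    using simplicial[OF i] x adjacent_sym by (auto simp: nbhd_iff)
  have "nbhd E i - {x} \<noteq> nbhd E x - {i}"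
  proof
    assume eq: "nbhd E i - {x} = nbhd E x - {i}"
    have same: "adjacent y i \<longleftrightarrow> adjacent y x" if "y \<noteq> i" "y \<noteq> x" for y
    proof -
      have "y \<in> nbhd E i - {x} \<longleftrightarrow> y \<in> nbhd E x - {i}" using eq by simp
      then show ?thesis using that adjacent_sym by (auto simp: nbhd_iff)
    qed
    have "i = x"
    proof (rule homogeneous_trivial[of "{i, x}"])
      show "{i, x} \<subseteq> V" using x adjacent_in_V by auto
      have "card {i, x} < 3" by (simp add: card_insert_if)
      then show "{i, x} \<noteq> V" using large by auto
    qed (use same in auto)
    then show False using x by simp
  qed
  then have "card (nbhd E i - {x}) < card (nbhd E x - {i})"
    using sub finite_nbhd by (intro psubset_card_mono) auto
  then show ?thesis
    using x adjacent_sym finite_nbhd by (simp add: deg_def nbhd_iff card_Diff_singleton)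
qed

text \<open>Otherwise \<open>i, x, y, w, l\<close> is an induced path: each of \<open>x\<close>,
  \<open>y\<close>, \<open>w\<close> has its own dominator only.\<close>

lemma cross_trans:
  assumes "i \<in> D" "j \<in> D" "l \<in> D" "i \<noteq> j" "j \<noteq> l" "i \<noteq> l"
    and "adjacent i x" "adjacent j y" "adjacent l w" "adjacent x y" "adjacent y w"
  shows "adjacent x w"
  using no_induced_P5[of i x y w l] assms D_independent dominator_unique adjacent_sym by metis

text \<open>Strengthens \<open>cross_trans\<close> to two different contact vertices in
  \<open>N(j)\<close>. If \<open>x\<close> and \<open>w\<close> were nonadjacent,
  \<open>cross_trans\<close> would also forbid the edges \<open>x y'\<close> and \<open>y w\<close>;
  as \<open>y\<close> and \<open>y'\<close> are adjacent in the clique \<open>N(j)\<close>,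
  \<open>i, x, y, y', w\<close> would be an induced path.\<close>

lemma cross_trans':
  assumes "i \<in> D" "j \<in> D" "l \<in> D" "i \<noteq> j" "j \<noteq> l" "i \<noteq> l"
    and "adjacent i x" "adjacent j y" "adjacent x y"
    and "adjacent j y'" "adjacent l w" "adjacent y' w"
  shows "adjacent x w"
proof (rule ccontr)
  assume "\<not> adjacent x w"
  then have n: "\<not> adjacent x w" "\<not> adjacent x y'" "\<not> adjacent y w"
    using assms cross_trans[of i j l x _ w] by blast+
  then have "y \<noteq> y'" using assms by blast
  then have "adjacent y y'" using assms simplicial by blast
  then show False
    using no_induced_P5[of i x y y' w] n assms dominator_unique by metis
qed

lemma nbhd_nonempty:
  assumes "i \<in> D" shows "\<exists>x. adjacent i x"
proof (rule ccontr)
  assume "\<nexists>x. adjacent i x"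
  then have "{i} = V" using assms D_in_V by (intro connected) auto
  then show False using large by auto
qed

text \<open>Connectedness gives a chain of dominators from \<open>i\<close> to \<open>l\<close> with
  an edge between consecutive neighbourhoods, and \<open>cross_trans'\<close> contracts it to a
  single edge.\<close>

lemma linked:
  assumes i: "i \<in> D" and l: "l \<in> D" "i \<noteq> l"
  shows "\<exists>x y. adjacent i x \<and> adjacent l y \<and> adjacent x y"
proof -
  \<comment> \<open>\<open>S\<close> collects the dominators directly linked to \<open>i\<close>.
    The set \<open>H\<close> that they dominate is closed under adjacency, hence everything; as
    \<open>D\<close> is independent, \<open>l\<close> can be in \<open>H\<close> only by being in
    \<open>S\<close>.\<close>
  define S where "S = {j \<in> D. j = i \<or> (\<exists>x y. adjacent i x \<and> adjacent j y \<and> adjacent x y)}"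
  define H where "H = {v. \<exists>j\<in>S. v = j \<or> adjacent j v}"
  have "H = V"
  proof (rule connected)
    show "H \<subseteq> V" using D_in_V adjacent_in_V by (auto simp: H_def S_def)
    show "H \<noteq> {}" using i by (auto simp: H_def S_def)
    fix x y assume "x \<in> H" and xy: "adjacent x y"
    then obtain j where j: "j \<in> S" "x = j \<or> adjacent j x" by (auto simp: H_def)
    have jD: "j \<in> D" using j by (simp add: S_def)
    show "y \<in> H"
    proof (cases "x = j \<or> adjacent j y")
      case True
      then show ?thesis using j xy by (auto simp: H_def)
    next
      case False
      then have jx: "adjacent j x" using j by simp
      have "y \<in> V" using xy adjacent_in_V by blast
      then consider "y \<in> D" | m where "m \<in> D" "adjacent m y" using dominated by blast
      then show ?thesis
      proof cases
        case 1
        then have "y = j" using jD jx xy dominator_unique adjacent_sym by metis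
        then show ?thesis using j by (auto simp: H_def)
      next
        case 2
        then have "j \<noteq> m" using False by auto
        have "m \<in> S"
        proof (cases "j = i \<or> m = i")
          case True
          then show ?thesis using 2 jx xy by (auto simp: S_def)
        next
          case ne: False
          then obtain u v where "adjacent i u" "adjacent j v" "adjacent u v"
            using j by (auto simp: S_def)
          then have "adjacent u y"
            using cross_trans'[of i j m u v x y] i jD 2 ne \<open>j \<noteq> m\<close> jx xy by auto
          then show ?thesis using 2 \<open>adjacent i u\<close> by (auto simp: S_def)
        qed
        then show ?thesis using 2 by (auto simp: H_def)
      qed
    qed
  qed
  then have "l \<in> H" using l D_in_V by simp
  then have "l \<in> S" using l D_independent by (auto simp: H_def S_def)
  then show ?thesis using l by (auto simp: S_def)
qed

text \<open>With three dominators, the vertices of \<open>N(i)\<close> that have neighbours outside \<open>N[i]\<close> are adjacent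
  to all such vertices of the other neighbourhoods; hence those without them are twins of \<open>i\<close>, and
  those with them are twins of each other.\<close>

lemma leaf_spider_of_three_dominators:
  assumes three: "\<And>i l. i \<in> D \<Longrightarrow> l \<in> D \<Longrightarrow> \<exists>j\<in>D. j \<noteq> i \<and> j \<noteq> l"
  shows "is_leaf_spider V E"
proof -
  define cross where "cross = (\<lambda>i x. \<exists>j\<in>D. \<exists>y. j \<noteq> i \<and> adjacent j y \<and> adjacent x y)"
  \<comment> \<open>A contact with one foreign neighbourhood yields a contact with all of them:
    \<open>linked\<close> joins \<open>N(j)\<close> to \<open>N(l)\<close>, and
    \<open>cross_trans'\<close> continues from \<open>x\<close>.\<close>
  have cross_all: "\<exists>w. adjacent l w \<and> adjacent x w"
    if x: "i \<in> D" "adjacent i x" "cross i x" "l \<in> D" "l \<noteq> i" for i x l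
  proof -
    obtain j y where j: "j \<in> D" "j \<noteq> i" "adjacent j y" "adjacent x y"
      using \<open>cross i x\<close> by (auto simp: cross_def)
    show ?thesis
    proof (cases "l = j")
      case True
      then show ?thesis using j by blast
    next
      case False
      then obtain y' w where "adjacent j y'" "adjacent l w" "adjacent y' w"
        using linked[OF j(1) x(4)] by blast
      then show ?thesis using cross_trans'[of i j l x y y' w] x j False by auto
    qed
  qed
  \<comment> \<open>Here the third dominator \<open>j\<close> is essential: both \<open>x\<close>
    and \<open>w\<close> have contacts in \<open>N(j)\<close>, through which
    \<open>cross_trans'\<close> joins them.\<close>
  have cross_clique: "adjacent x w"
    if xw: "i \<in> D" "adjacent i x" "cross i x" "l \<in> D" "l \<noteq> i" "adjacent l w" "cross l w"
    for i x l w
  proof -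
    obtain j where j: "j \<in> D" "j \<noteq> i" "j \<noteq> l" using three xw by blast
    obtain y y' where "adjacent j y" "adjacent x y" "adjacent j y'" "adjacent w y'"
      using cross_all[of i x j] cross_all[of l w j] xw j by blast
    then show ?thesis
      using cross_trans'[of i j l x y y' w] xw j adjacent_sym by auto
  qed
  have is_cross: "cross i x" if i: "i \<in> D" and x: "adjacent i x" for i x
  proof (rule ccontr)
    assume nx: "\<not> cross i x"
    define H where "H = insert i {y. adjacent i y \<and> \<not> cross i y}"
    \<comment> \<open>A second dominator lies outside \<open>H\<close> and keeps \<open>H\<close>
      different from \<open>V\<close>.\<close>
    obtain l where l: "l \<in> D" "l \<noteq> i" using three i by blast
    have "i = x"
    proof (rule homogeneous_trivial[of H])
      show "H \<subseteq> V" using i D_in_V adjacent_in_V by (auto simp: H_def)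
      show "H \<noteq> V" using i l D_in_V D_independent by (auto simp: H_def)
      show "i \<in> H" "x \<in> H" using x nx by (auto simp: H_def)
      fix y assume y: "y \<in> V - H"
      show "(\<forall>h\<in>H. adjacent y h) \<or> (\<forall>h\<in>H. \<not> adjacent y h)"
      proof (cases "adjacent i y")
        case True
        then have "cross i y" using y by (auto simp: H_def)
        then show ?thesis
          using True simplicial[OF i True] adjacent_sym by (auto simp: H_def)
      next
        case False
        then consider "y \<in> D" "y \<noteq> i" | j where "j \<in> D" "adjacent j y" "j \<noteq> i"
          using dominated y by (auto simp: H_def)
        then show ?thesis
        proof cases
          case 1
          then show ?thesis
            using i D_independent dominator_unique by (auto simp: H_def)
        next
          case 2
          then show ?thesis
            using False adjacent_sym by (auto simp: H_def cross_def)
        qed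
      qed
    qed
    then show False using x by simp
  qed
  have complete: "adjacent x w" if "i \<in> D" "adjacent i x" "l \<in> D" "adjacent l w" "x \<noteq> w" for i x l w
    using that cross_clique[of i x l w] is_cross simplicial by blast
  have single: "x = y" if i: "i \<in> D" and xy: "adjacent i x" "adjacent i y" for i x y
  proof (rule homogeneous_trivial[of "{z. adjacent i z}"])
    show "{z. adjacent i z} \<subseteq> V" using adjacent_in_V by auto
    show "{z. adjacent i z} \<noteq> V" using D_in_V[OF i] adjacent_irrefl by blast
    show "x \<in> {z. adjacent i z}" "y \<in> {z. adjacent i z}" using xy by auto
    fix v assume v: "v \<in> V - {z. adjacent i z}"
    show "(\<forall>h\<in>{z. adjacent i z}. adjacent v h) \<or> (\<forall>h\<in>{z. adjacent i z}. \<not> adjacent v h)"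
    proof (cases "v \<in> D")
      case True
      then show ?thesis using i dominator_unique by blast
    next
      case False
      \<comment> \<open>As \<open>v\<close> is outside \<open>N(i)\<close>, it differs from every
        member, so \<open>complete\<close> makes it adjacent to all of \<open>N(i)\<close>.\<close>
      then obtain j where "j \<in> D" "adjacent j v" using v dominated by blast
      then show ?thesis using i v complete[of j v i] by blast
    qed
  qed
  have outside: "\<exists>i\<in>D. adjacent i v" if "v \<in> V - D" for v
    using that dominated by blast
  have "leaves V E = D"
  proof (rule set_eqI)
    fix v
    have "deg E v = 1" if v: "v \<in> D"
    proof -
      obtain x where "adjacent v x" using nbhd_nonempty[OF v] by blast
      then have "nbhd E v = {x}" using single[OF v] by (auto simp: nbhd_iff)
      then show ?thesis by (simp add: deg_def)
    qed
    \<comment> \<open>Such a vertex has two neighbours: its dominator \<open>i\<close> and some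
      \<open>w\<close> dominated by another \<open>l\<close>. They differ because dominators are not
      adjacent.\<close>
    moreover have "deg E v \<noteq> 1" if v: "v \<in> V - D"
    proof
      assume "deg E v = 1"
      then obtain a where a: "nbhd E v = {a}" by (auto simp: deg_def card_1_singleton_iff)
      obtain i where i: "i \<in> D" "adjacent i v" using outside v by blast
      obtain l where l: "l \<in> D" "l \<noteq> i" using three i by blast
      obtain w where w: "adjacent l w" using nbhd_nonempty l by blast
      have "v \<noteq> w" using i l w dominator_unique by blast
      then have "adjacent v w" using complete i l w by blast
      then have "i = w" using a i adjacent_sym by (metis nbhd_iff singletonD)
      then show False using w l i D_independent by blast
    qed
    ultimately show "v \<in> leaves V E \<longleftrightarrow> v \<in> D"
      using D_in_V by (auto simp: leaves_def)
  qed
  moreover have "thin_spider_partition V E (V - D) D"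
    unfolding thin_spider_partition_def
  proof (intro conjI ballI)
    show "(V - D) \<union> D = V" using D_in_V by auto
    show "clique E (V - D)"
      unfolding clique_def adjacent_def[symmetric] using outside complete by blast
    show "independent_set E D"
      unfolding independent_set_def adjacent_def[symmetric] using D_independent by blast
    show "\<exists>!i. i \<in> D \<and> {c, i} \<in> E" if "c \<in> V - D" for c
      unfolding adjacent_def[symmetric] using outside[OF that] dominator_unique adjacent_sym by metis
    show "\<exists>!c. c \<in> V - D \<and> {c, i} \<in> E" if i: "i \<in> D" for i
      unfolding adjacent_def[symmetric]
      using nbhd_nonempty[OF i] single[OF i] i D_independent adjacent_in_V adjacent_sym
      by (metis DiffI)
  qed auto
  ultimately show ?thesis by (auto simp: is_leaf_spider_def)
qed

text \<open>By \<open>deg_less\<close>, a dominator of \<open>d\<close> in \<open>S\<close> would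
  beat \<open>d\<close>. The set \<open>S\<close> is a parameter so that both choices are covered,
  from \<open>V\<close> and from \<open>V - closed_nbhd E d\<close>.\<close>

lemma min_degree_dominator:
  assumes "min_degree_in E S d" "S \<subseteq> V" "\<And>i. i \<in> D \<Longrightarrow> adjacent i d \<Longrightarrow> i \<in> S"
  shows "d \<in> D"
proof (rule ccontr)
  assume "d \<notin> D"
  moreover have "d \<in> S" "\<And>i. i \<in> S \<Longrightarrow> \<not> deg E i < deg E d"
    using assms(1) by (auto simp: min_degree_in_def is_arg_min_def)
  ultimately show False using assms(2,3) dominated[of d] deg_less[of _ d] by blast
qed

lemma clique_nbhd: "d \<in> D \<Longrightarrow> clique E (nbhd E d)"
  using simplicial by (auto simp: clique_def nbhd_iff adjacent_def)

text \<open>Both chosen vertices lie in \<open>D\<close>, and a graph that is not a spider has no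
  third dominator.\<close>

lemma min_degree_pair:
  assumes "\<not> is_leaf_spider V E" and d: "min_degree_in E V d"
    and d': "min_degree_in E (V - closed_nbhd E d) d'"
  shows "d \<in> D" "D = {d, d'}"
proof -
  show dD: "d \<in> D"
    using min_degree_dominator[OF d] D_in_V by blast
  have "d' \<notin> closed_nbhd E d"
    using d' by (auto simp: min_degree_in_def is_arg_min_def)
  then have d'D: "d' \<in> D" "d' \<noteq> d"
    using min_degree_dominator[OF d'] dD D_in_V D_independent by (auto simp: closed_nbhd_iff)
  obtain i l where il: "i \<in> D" "l \<in> D" "D \<subseteq> {i, l}"
    using leaf_spider_of_three_dominators assms(1) by blast
  then show "D = {d, d'}" using dD d'D by blast
qed

end

text \<open>Each output is an e.d. by \<open>leaf_spider_efficient\<close>, by domination of all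
  vertices by \<open>d\<close>, or by the final check. The negative outcomes contradict
  \<open>min_degree_dominator\<close>, \<open>min_degree_pair\<close> and \<open>clique_nbhd\<close>
  if some \<open>D\<close> exists.\<close>

theorem ED_correct:
  assumes graph: "fin_simple_graph V E" and "prime_graph V E" "P5_free V E" and "ED V E r"
  shows "correct_outcome V E r"
proof -
  interpret simple_graph V E by unfold_locales fact
  \<comment> \<open>A failed clique test exhibits three vertices, \<open>d\<close> and two
    nonadjacent neighbours, so the structure theory applies to both \<open>Stop\<close>
    cases.\<close>
  have large: "3 \<le> card V" if nc: "\<not> clique E (nbhd E d)" and "d \<in> V" for d
  proof -
    obtain u v where uv: "adjacent d u" "adjacent d v" "u \<noteq> v"
      using nc by (auto simp: clique_def nbhd_iff)
    then have "card {d, u, v} \<le> card V"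
      using finite_V adjacent_in_V by (intro card_mono) auto
    moreover have "d \<noteq> u" "d \<noteq> v" using uv by auto
    ultimately show ?thesis using uv by simp
  qed
  have loc: "prime_P5_free_graph_ed V E D" if "3 \<le> card V" "efficient_dominating_set V E D" for D
    using assms that by unfold_locales
  show ?thesis using assms(4)
  proof cases
    case spider
    then show ?thesis using leaf_spider_efficient by (simp add: correct_outcome_def)
  next
    case (stop1 d)
    then have "3 \<le> card V" using large by (auto simp: min_degree_in_def is_arg_min_def)
    then show ?thesis
      using stop1 loc prime_P5_free_graph_ed.min_degree_dominator[of V E _ V d]
        prime_P5_free_graph_ed.clique_nbhd[of V E _ d] prime_P5_free_graph_ed.D_in_V[of V E]
      by (auto simp: correct_outcome_def)
  next
    case (universal d)
    then show ?thesis
      by (auto simp: correct_outcome_def efficient_dominating_set_def min_degree_in_def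
          is_arg_min_def)
  next
    case (stop2 d d')
    then have "3 \<le> card V" using large by (auto simp: min_degree_in_def is_arg_min_def)
    then show ?thesis
      using stop2 loc prime_P5_free_graph_ed.min_degree_pair[of V E _ d d']
        prime_P5_free_graph_ed.clique_nbhd[of V E _ d']
      by (auto simp: correct_outcome_def)
  next
    case found
    then show ?thesis by (simp add: correct_outcome_def)
  next
    case (not_found d d')
    show ?thesis
    proof (cases "3 \<le> card V")
      case True
      then show ?thesis
        using not_found loc prime_P5_free_graph_ed.min_degree_pair[of V E _ d d']
        by (auto simp: correct_outcome_def)
    next
      case False
      have dd': "d \<in> V" "d' \<in> V" "d' \<noteq> d" "\<not> adjacent d d'"
        using not_found by (auto simp: min_degree_in_def is_arg_min_def closed_nbhd_iff)
      \<comment> \<open>With at most two vertices the nonadjacent pair is the whole graph and thus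
        an e.d., so the final check cannot have failed.\<close>
      have "{d, d'} = V"
        using dd' False finite_V by (intro card_seteq) auto
      then have "efficient_dominating_set V E {d, d'}"
        using dd' adjacent_sym
        by (auto simp: efficient_dominating_set_def closed_nbhd_iff)
      then show ?thesis using not_found by simp
    qed
  qed
qed

section \<open>Counting criteria tested by the program\<close>

lemma ex1_iff_card: "(\<exists>!u. P u) \<longleftrightarrow> card {u. P u} = 1"
  by (auto simp: card_1_singleton_iff set_eq_iff)

context simple_graph
begin

text \<open>Half of the handshake lemma, by double counting incidences; it is the source of every
  \<open>card E\<close> in the time bounds.\<close>

lemma sum_deg_le: "(\<Sum>v\<in>V. deg E v) \<le> 2 * card E"
proof -
  have finE: "finite E"
    using graph finite_V by (auto simp: fin_simple_graph_def intro!: finite_subset[of E "Pow V"])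
  have "deg E v \<le> card {e \<in> E. v \<in> e}" for v
    unfolding deg_def
    by (rule card_inj_on_le[of "\<lambda>u. {u, v}"])
      (use finE in \<open>auto simp: inj_on_def nbhd_def doubleton_eq_iff\<close>)
  then have "(\<Sum>v\<in>V. deg E v) \<le> (\<Sum>v\<in>V. card {e \<in> E. v \<in> e})"
    by (rule sum_mono)
  also have "\<dots> = 2 * card E"
  proof (rule sum_multicount[OF finite_V finE], rule ballI)
    fix e assume "e \<in> E"
    then have "e \<subseteq> V" "card e = 2" using graph by (auto simp: fin_simple_graph_def)
    moreover from \<open>e \<subseteq> V\<close> have "{v \<in> V. v \<in> e} = e" by auto
    ultimately show "card {v \<in> V. v \<in> e} = 2" by simp
  qed
  finally show ?thesis .
qed

text \<open>The non-leaf neighbours of a non-leaf \<open>v\<close> lie in \<open>C - {v}\<close>, so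
  one leaf neighbour and degree \<open>|C|\<close> force \<open>v\<close> to be adjacent to all of
  \<open>C - {v}\<close>. Conversely, a leaf has a single neighbour by its degree, and the count
  \<open>0\<close> places that neighbour in \<open>C\<close>.\<close>

lemma leaf_spider_iff:
  "is_leaf_spider V E \<longleftrightarrow> (\<forall>v\<in>V.
     if deg E v = 1 then card {u \<in> nbhd E v. deg E u = 1} = 0
     else card {u \<in> nbhd E v. deg E u = 1} = 1 \<and> deg E v = card {u \<in> V. deg E u \<noteq> 1})"
  (is "_ \<longleftrightarrow> ?R")
proof -
  define L where "L = leaves V E"
  define K where "K v = {u \<in> nbhd E v. deg E u = 1}" for v
  have K_eq: "K v = {u \<in> L. adjacent v u}" for v
    using adjacent_in_V by (auto simp: K_def L_def leaves_def nbhd_iff)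
  have finK: "finite (K v)" for v by (simp add: K_def finite_nbhd)
  have C_eq: "{u \<in> V. deg E u \<noteq> 1} = V - L" by (auto simp: L_def leaves_def)
  have L: "v \<in> L \<longleftrightarrow> v \<in> V \<and> deg E v = 1" for v by (auto simp: L_def leaves_def)
  have rest: "nbhd E v - K v \<subseteq> V - L - {v}" for v
    using nbhd_subset by (auto simp: K_eq nbhd_iff)
  have split: "deg E v = card (K v) + card (nbhd E v - K v)" for v
    using card_Un_disjoint[of "K v" "nbhd E v - K v"] finite_nbhd finK
    by (simp add: deg_def K_def Un_absorb1)
  have fin: "finite (V - L - {v})" for v using finite_V by simp
  have cardC: "card (V - L) = card (V - L - {v}) + 1" if "v \<in> V - L" for v
    using that finite_V by (simp add: card_Suc_Diff1 del: card_Diff_insert)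
  show ?thesis
  proof
    assume "is_leaf_spider V E"
    then obtain C where C: "thin_spider_partition V E C L"
      by (auto simp: is_leaf_spider_def L_def)
    then have CV: "C = V - L" by (auto simp: thin_spider_partition_def)
    have "if deg E v = 1 then card (K v) = 0 else card (K v) = 1 \<and> deg E v = card (V - L)"
      if v: "v \<in> V" for v
    proof (cases "deg E v = 1")
      case True
      then have "K v = {}"
        using C v L by (auto simp: thin_spider_partition_def independent_set_def K_eq adjacent_def)
      then show ?thesis using True by simp
    next
      case False
      then have vC: "v \<in> V - L" using v L by simp
      then have "\<exists>!i. i \<in> L \<and> adjacent v i"
        using C CV by (auto simp: thin_spider_partition_def adjacent_def)
      then obtain i where "K v = {i}" by (auto simp: K_eq)
      moreover have "nbhd E v - K v = V - L - {v}"
      proof (rule antisym[OF rest])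
        show "V - L - {v} \<subseteq> nbhd E v - K v"
          using C CV vC by (auto simp: thin_spider_partition_def clique_def nbhd_iff adjacent_def K_eq)
      qed
      ultimately show ?thesis using False split[of v] cardC[OF vC] by simp
    qed
    then show ?R unfolding C_eq K_def by blast
  next
    assume ?R
    then have R: "if deg E v = 1 then card (K v) = 0 else card (K v) = 1 \<and> deg E v = card (V - L)"
      if "v \<in> V" for v
      using that unfolding C_eq K_def by blast
    have Kempty: "K v = {}" if "v \<in> L" for v
      using R[of v] that finK[of v] by (auto simp: L)
    have KC: "card (K v) = 1" "deg E v = card (V - L)" if "v \<in> V - L" for v
      using R[of v] that by (auto simp: L)
    have "thin_spider_partition V E (V - L) L"
      unfolding thin_spider_partition_def adjacent_def[symmetric]
    proof (intro conjI ballI)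
      show "(V - L) \<union> L = V" by (auto simp: L)
      show "independent_set E L"
        using Kempty by (auto simp: independent_set_def K_eq adjacent_def)
      show "clique E (V - L)"
        unfolding clique_def adjacent_def[symmetric]
      proof (intro ballI impI)
        fix v w assume v: "v \<in> V - L" and w: "w \<in> V - L" "v \<noteq> w"
        have "nbhd E v - K v = V - L - {v}"
          using split[of v] KC[OF v] cardC[OF v] by (intro card_subset_eq[OF fin rest]) simp
        then have "w \<in> nbhd E v" using w by blast
        then show "adjacent v w" by (simp add: nbhd_iff)
      qed
      show "\<exists>!i. i \<in> L \<and> adjacent c i" if "c \<in> V - L" for c
        using KC(1)[OF that] by (simp add: ex1_iff_card K_eq)
      show "\<exists>!c. c \<in> V - L \<and> adjacent c i" if i: "i \<in> L" for i
      proof -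
        obtain c where c: "nbhd E i = {c}"
          using i by (auto simp: L deg_def card_1_singleton_iff)
        then have adj: "adjacent u i \<longleftrightarrow> u = c" for u
          using nbhd_iff[of u i] adjacent_sym by auto
        then have "c \<in> V - L"
          using Kempty[OF i] adjacent_in_V(1)[of c i] adjacent_sym by (auto simp: K_eq)
        then show ?thesis using adj by auto
      qed
    qed auto
    then show "is_leaf_spider V E" by (auto simp: is_leaf_spider_def L_def)
  qed
qed

text \<open>The neighbours of \<open>u\<close> inside \<open>N(x)\<close> form a subset of
  \<open>N(x) - {u}\<close>, which has \<open>deg E x - 1\<close> elements; equal size means
  equality.\<close>

lemma clique_nbhd_iff:
  "clique E (nbhd E x) \<longleftrightarrow>
     (\<forall>u\<in>nbhd E x. card {w \<in> nbhd E u. w \<in> nbhd E x} + 1 = deg E x)"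
proof -
  have "(card {w \<in> nbhd E u. w \<in> nbhd E x} + 1 = deg E x) \<longleftrightarrow>
      (\<forall>v\<in>nbhd E x. u \<noteq> v \<longrightarrow> {u, v} \<in> E)" if u: "u \<in> nbhd E x" for u
  proof -
    have sub: "{w \<in> nbhd E u. w \<in> nbhd E x} \<subseteq> nbhd E x - {u}"
      by (auto simp: nbhd_iff)
    have "deg E x = card (nbhd E x - {u}) + 1"
      using u finite_nbhd by (simp add: deg_def card_Suc_Diff1 del: card_Diff_insert)
    then have "(card {w \<in> nbhd E u. w \<in> nbhd E x} + 1 = deg E x) \<longleftrightarrow>
        {w \<in> nbhd E u. w \<in> nbhd E x} = nbhd E x - {u}"
      using card_subset_eq[OF _ sub] finite_nbhd by auto
    also have "\<dots> \<longleftrightarrow> (\<forall>v\<in>nbhd E x. u \<noteq> v \<longrightarrow> {u, v} \<in> E)"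
      using sub by (auto simp: nbhd_iff adjacent_def)
    finally show ?thesis .
  qed
  then show ?thesis unfolding clique_def by simp
qed

text \<open>The sum is the number of dominators of \<open>v\<close> in \<open>{d, e}\<close>: the
  first summand stands for \<open>v\<close> itself, which is not its own neighbour.\<close>

lemma efficient_pair_iff:
  assumes "d \<in> V" "e \<in> V"
  shows "efficient_dominating_set V E {d, e} \<longleftrightarrow> (\<forall>v\<in>V.
    (if v = d \<or> v = e then 1 else 0) + card {u \<in> nbhd E v. u = d \<or> u = e} = 1)"
proof -
  have "(\<exists>!u. u \<in> {d, e} \<and> v \<in> closed_nbhd E u) \<longleftrightarrow>
      (if v = d \<or> v = e then 1 else 0) + card {u \<in> nbhd E v. u = d \<or> u = e} = 1" for v
  proof -
    define K where "K = {u \<in> nbhd E v. u = d \<or> u = e}"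
    have K: "finite K" "v \<notin> K" by (simp_all add: K_def nbhd_iff)
    have "{u. u \<in> {d, e} \<and> v \<in> closed_nbhd E u} = (if v = d \<or> v = e then insert v K else K)"
      using adjacent_sym by (auto simp: K_def nbhd_iff closed_nbhd_iff)
    then have "card {u. u \<in> {d, e} \<and> v \<in> closed_nbhd E u}
        = (if v = d \<or> v = e then 1 else 0) + card K"
      using K by simp
    then show ?thesis by (simp add: ex1_iff_card K_def)
  qed
  then show ?thesis using assms by (simp add: efficient_dominating_set_def)
qed

end

section \<open>Reasoning about programs\<close>

definition result :: "com \<Rightarrow> state \<Rightarrow> state" where
  "result c s = fst (exec c s)"

definition steps :: "com \<Rightarrow> state \<Rightarrow> nat" where
  "steps c s = snd (exec c s)"

abbreviation set_reg :: "state \<Rightarrow> string \<Rightarrow> nat \<Rightarrow> state" where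
  "set_reg s x i \<equiv> s\<lparr>reg := (reg s)(x := i)\<rparr>"

lemma result_simps [simp]:
  "result (Assign x a) s = set_reg s x (aval a s)"
  "result (Write y a b) s = s\<lparr>arr := (arr s)(y := (arr s y)(aval a s := aval b s))\<rparr>"
  "result (c ;; d) s = result d (result c s)"
  "result (Cond be c d) s = (if bval be s then result c s else result d s)"
  "result Skip s = s"
  by (simp_all add: result_def Let_def split_beta)

lemma steps_simps [simp]:
  "steps (Assign x a) s = acost a + 1"
  "steps (Write y a b) s = acost a + acost b + 1"
  "steps (c ;; d) s = steps c s + steps d (result c s)"
  "steps (Cond be c d) s = bcost be + (if bval be s then steps c s else steps d s) + 1"
  "steps Skip s = 1"
  by (simp_all add: steps_def result_def Let_def split_beta)

lemma result_For:
  "result (For x a b c) s = fold (\<lambda>i s. result c (set_reg s x i)) [aval a s..<aval b s] s"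
proof -
  have "fst (fold (\<lambda>i (s, t). let (s', t') = exec c (set_reg s x i) in (s', t + t' + 1)) is (s, t))
      = fold (\<lambda>i s. result c (set_reg s x i)) is s" for "is" t
    by (induction "is" arbitrary: s t) (simp_all add: result_def Let_def split_beta)
  then show ?thesis by (simp add: result_def)
qed

section \<open>Frame conditions and loop invariants\<close>

primrec written_regs :: "com \<Rightarrow> string set" where
  "written_regs (Assign x a) = {x}"
| "written_regs (Write y a b) = {}"
| "written_regs (c ;; d) = written_regs c \<union> written_regs d"
| "written_regs (Cond b c d) = written_regs c \<union> written_regs d"
| "written_regs (For x a b c) = insert x (written_regs c)"
| "written_regs Skip = {}"

primrec written_arrs :: "com \<Rightarrow> string set" where
  "written_arrs (Assign x a) = {}"
| "written_arrs (Write y a b) = {y}"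
| "written_arrs (c ;; d) = written_arrs c \<union> written_arrs d"
| "written_arrs (Cond b c d) = written_arrs c \<union> written_arrs d"
| "written_arrs (For x a b c) = written_arrs c"
| "written_arrs Skip = {}"

definition agree :: "string set \<Rightarrow> string set \<Rightarrow> state \<Rightarrow> state \<Rightarrow> bool" where
  "agree R A s s' \<longleftrightarrow>
     (\<forall>x. x \<notin> R \<longrightarrow> reg s' x = reg s x) \<and> (\<forall>y. y \<notin> A \<longrightarrow> arr s' y = arr s y)"

lemma agree_reg: "agree R A s s' \<Longrightarrow> x \<notin> R \<Longrightarrow> reg s' x = reg s x"
  by (simp add: agree_def)

lemma agree_arr: "agree R A s s' \<Longrightarrow> y \<notin> A \<Longrightarrow> arr s' y = arr s y"
  by (simp add: agree_def)

lemma agree_refl: "agree R A s s"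
  by (simp add: agree_def)

lemma agree_trans: "agree R A s s' \<Longrightarrow> agree R A s' s'' \<Longrightarrow> agree R A s s''"
  by (simp add: agree_def)

lemma agree_mono: "agree R A s s' \<Longrightarrow> R \<subseteq> R' \<Longrightarrow> A \<subseteq> A' \<Longrightarrow> agree R' A' s s'"
  unfolding agree_def by blast

lemma agree_set_reg: "x \<in> R \<Longrightarrow> agree R A s (set_reg s x i)"
  by (auto simp: agree_def)

lemma result_agree: "agree (written_regs c) (written_arrs c) s (result c s)"
proof (induction c arbitrary: s)
  case (Seq c d)
  then show ?case by (auto simp: agree_def)
next
  case (Cond b c d)
  then show ?case by (auto simp: agree_def)
next
  case (For x a b c)
  have "agree (insert x (written_regs c)) (written_arrs c) s
      (fold (\<lambda>i s. result c (set_reg s x i)) is s)" for "is"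
  proof (induction "is" arbitrary: s)
    case (Cons i "is")
    have "agree (insert x (written_regs c)) (written_arrs c) s (result c (set_reg s x i))"
      using For[of "set_reg s x i"] by (auto simp: agree_def)
    from agree_trans[OF this Cons] show ?case unfolding fold_simps .
  qed (simp add: agree_refl)
  then show ?case by (simp add: result_For)
qed (auto simp: agree_def)

text \<open>The body may assume that everything the loop does not write is unchanged since its
  start, so invariants need not repeat the input data. \<open>T i\<close> bounds one iteration; the
  added \<open>1\<close> is the loop step itself.\<close>

lemma For_invariant:
  assumes le: "aval a s \<le> aval b s" and init: "I (aval a s) s"
    and body: "\<And>i s'. \<lbrakk>aval a s \<le> i; i < aval b s; I i s';
        agree (insert x (written_regs c)) (written_arrs c) s s'\<rbrakk>
      \<Longrightarrow> I (Suc i) (result c (set_reg s' x i)) \<and> steps c (set_reg s' x i) \<le> T i"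
  shows "I (aval b s) (result (For x a b c) s)"
    and "steps (For x a b c) s \<le> acost a + acost b + 1 + (\<Sum>i = aval a s..<aval b s. T i + 1)"
proof -
  \<comment> \<open>Induction over prefixes of the index range carries invariant, frame condition
    and time together, because the hypothesis on the body needs the first two to yield the
    third.\<close>
  define f where "f = (\<lambda>i (s, t). let (s', t') = exec c (set_reg s x i) in (s', t + t' + 1))"
  let ?R = "insert x (written_regs c)" and ?A = "written_arrs c"
  have "I k s' \<and> agree ?R ?A s s' \<and> t \<le> acost a + acost b + 1 + (\<Sum>i = aval a s..<k. T i + 1)"
    if "aval a s \<le> k" "k \<le> aval b s"
      "fold f [aval a s..<k] (s, acost a + acost b + 1) = (s', t)" for k s' t
    using that
  proof (induction k arbitrary: s' t rule: dec_induct)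
    case base
    then show ?case using init by (simp add: agree_refl)
  next
    case (step k)
    obtain s1 t1 where 1: "fold f [aval a s..<k] (s, acost a + acost b + 1) = (s1, t1)"
      by fastforce
    have IH: "I k s1" "agree ?R ?A s s1"
      "t1 \<le> acost a + acost b + 1 + (\<Sum>i = aval a s..<k. T i + 1)"
      using step.IH[OF _ 1] step.prems by auto
    have "f k (s1, t1) = (s', t)"
      using step.prems(2) step.hyps(1) 1 by simp
    then have eq: "s' = result c (set_reg s1 x k)" "t = t1 + steps c (set_reg s1 x k) + 1"
      by (auto simp: f_def Let_def split_beta result_def steps_def)
    have "agree ?R ?A s s'"
      unfolding eq
      using IH(2) agree_set_reg[of x ?R ?A s1 k]
        agree_mono[OF result_agree[of c "set_reg s1 x k"], of ?R ?A]
      by (blast intro: agree_trans)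
    then show ?case
      using body[of k s1] step IH eq by auto
  qed
  from this[OF le order_refl prod.collapse[symmetric]]
  show "I (aval b s) (result (For x a b c) s)"
    and "steps (For x a b c) s \<le> acost a + acost b + 1 + (\<Sum>i = aval a s..<aval b s. T i + 1)"
    unfolding result_def steps_def f_def by simp_all
qed

lemma written_simps [simp]:
  "written_regs (for_vertices x c) = insert x (written_regs c)"
  "written_regs (for_positions j x c) = insert j (written_regs c)"
  "written_regs (increment x) = {x}"
  "written_arrs (for_vertices x c) = written_arrs c"
  "written_arrs (for_positions j x c) = written_arrs c"
  "written_arrs (increment x) = {}"
  by (simp_all add: for_vertices_def for_positions_def increment_def)

lemma increment_simps [simp]:
  "result (increment x) s = set_reg s x (reg s x + 1)" "steps (increment x) s = 4"
  by (simp_all add: increment_def)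

text \<open>\<open>off\<close> and \<open>adj\<close> are fixed functions, not arrays of one state,
  so that all intermediate states are compared with the same lists.\<close>

locale graph_input = simple_graph "{..<n}" E for n :: nat and E :: "nat set set" +
  fixes off adj :: "nat \<Rightarrow> nat"
  assumes off_mono: "v < n \<Longrightarrow> off v \<le> off (Suc v)"
    and adj_bij: "v < n \<Longrightarrow> bij_betw adj {off v..<off (Suc v)} (nbhd E v)"
begin

definition represents :: "state \<Rightarrow> bool" where
  "represents s \<longleftrightarrow> reg s ''n'' = n \<and> arr s ''off'' = off \<and> arr s ''adj'' = adj"

lemma represents_simps:
  assumes "represents s"
  shows "reg s ''n'' = n" "arr s ''off'' = off" "arr s ''adj'' = adj"
  using assms by (simp_all add: represents_def)

lemma represents_agree:
  assumes "agree R A s s'" "represents s" "''n'' \<notin> R" "''off'' \<notin> A" "''adj'' \<notin> A"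
  shows "represents s'"
  using assms by (simp add: represents_def agree_def)

lemma nbhd_less: "u \<in> nbhd E v \<Longrightarrow> u < n"
  using nbhd_subset by auto

text \<open>Linear time of a nested loop: \<open>a\<close> is the fixed cost per vertex,
  \<open>b\<close> the cost per entry of its adjacency list.\<close>

lemma sum_le_size: "(\<Sum>v<n. a + b * deg E v) \<le> a * n + 2 * b * card E"
proof -
  have "(\<Sum>v<n. a + b * deg E v) = a * n + b * (\<Sum>v<n. deg E v)"
    by (simp add: sum.distrib sum_distrib_left)
  also have "\<dots> \<le> a * n + b * (2 * card E)"
    using sum_deg_le by (intro add_left_mono mult_le_mono) auto
  finally show ?thesis by simp
qed

lemma for_vertices_invariant:
  assumes "reg s ''n'' = n" and "I 0 s"
    and "\<And>v s'. \<lbrakk>v < n; I v s'; agree (insert x (written_regs c)) (written_arrs c) s s'\<rbrakk>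
      \<Longrightarrow> I (Suc v) (result c (set_reg s' x v)) \<and> steps c (set_reg s' x v) \<le> T v"
  shows "I n (result (for_vertices x c) s)"
    and "steps (for_vertices x c) s \<le> 3 + (\<Sum>v<n. T v + 1)"
  using For_invariant[of "Const 0" s "Reg ''n''" I x c T] assms
  by (simp_all add: for_vertices_def atLeast0LessThan)

text \<open>The invariant depends on the set of neighbours already visited, not on the position,
  which hides the arbitrary order of the lists. Injectivity of \<open>adj\<close> makes each visited
  neighbour new, so counters equal cardinalities.\<close>

lemma for_positions_invariant:
  assumes s: "represents s" and v: "reg s x < n" and init: "I {} s"
    and body: "\<And>S i s'. \<lbrakk>adj i \<in> nbhd E (reg s x) - S; S \<subseteq> nbhd E (reg s x); I S s';
        agree (insert j (written_regs c)) (written_arrs c) s s'\<rbrakk>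
      \<Longrightarrow> I (insert (adj i) S) (result c (set_reg s' j i)) \<and> steps c (set_reg s' j i) \<le> T (adj i)"
  shows "I (nbhd E (reg s x)) (result (for_positions j x c) s)"
    and "steps (for_positions j x c) s \<le> 7 + (\<Sum>u\<in>nbhd E (reg s x). T u + 1)"
proof -
  let ?v = "reg s x"
  let ?a = "Read ''off'' (Reg x)" and ?b = "Read ''off'' (Add (Reg x) (Const 1))"
  have bnd: "aval ?a s = off ?v" "aval ?b s = off (Suc ?v)"
    using s by (simp_all add: represents_def)
  have bij: "inj_on adj {off ?v..<off (Suc ?v)}"
    "adj ` {off ?v..<off (Suc ?v)} = nbhd E ?v"
    using adj_bij[OF v] by (auto simp: bij_betw_def)
  have step: "I (adj ` {off ?v..<Suc i}) (result c (set_reg s' j i)) \<and>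
      steps c (set_reg s' j i) \<le> T (adj i)"
    if i: "off ?v \<le> i" "i < off (Suc ?v)" and I: "I (adj ` {off ?v..<i}) s'"
      and ag: "agree (insert j (written_regs c)) (written_arrs c) s s'" for i s'
  proof -
    have "adj i \<notin> adj ` {off ?v..<i}"
      using inj_on_image_mem_iff[OF bij(1), of i "{off ?v..<i}"] i by auto
    moreover have "adj i \<in> nbhd E ?v" "adj ` {off ?v..<i} \<subseteq> nbhd E ?v"
      unfolding bij(2)[symmetric] using i by auto
    moreover have "{off ?v..<Suc i} = insert i {off ?v..<i}" using i by auto
    ultimately show ?thesis using body[OF _ _ I ag] by simp
  qed
  have inv: "I (adj ` {off ?v..<off (Suc ?v)}) (result (For j ?a ?b c) s)"
    "steps (For j ?a ?b c) s
      \<le> acost ?a + acost ?b + 1 + (\<Sum>i = off ?v..<off (Suc ?v). T (adj i) + 1)"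
    using For_invariant[of ?a s ?b "\<lambda>i s'. I (adj ` {off ?v..<i}) s'" j c "\<lambda>i. T (adj i)"]
    unfolding bnd using off_mono[OF v] init step by auto
  have "(\<Sum>i = off ?v..<off (Suc ?v). T (adj i) + 1) = (\<Sum>u\<in>nbhd E ?v. T u + 1)"
    using sum.reindex_bij_betw[OF adj_bij[OF v], of "\<lambda>u. T u + 1"] by simp
  with inv show "I (nbhd E (reg s x)) (result (for_positions j x c) s)"
    and "steps (for_positions j x c) s \<le> 7 + (\<Sum>u\<in>nbhd E (reg s x). T u + 1)"
    by (simp_all add: bij(2) for_positions_def)
qed

text \<open>The common inner loop of the spider, clique and pair tests. The factor
  \<open>bcost b + 6\<close> is the test, an increment of cost \<open>4\<close>, the branching and
  the loop step.\<close>

lemma count_positions: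
  assumes s: "represents s" "reg s x < n" and jk: "j \<noteq> k"
    and b: "\<And>s'. agree {j, k} {} s s' \<Longrightarrow> adj (reg s' j) \<in> nbhd E (reg s x)
      \<Longrightarrow> bval b s' \<longleftrightarrow> P (adj (reg s' j))"
  shows "reg (result (for_positions j x (Cond b (increment k) Skip)) s) k
      = reg s k + card {u \<in> nbhd E (reg s x). P u}"
    and "steps (for_positions j x (Cond b (increment k) Skip)) s
      \<le> 7 + (bcost b + 6) * deg E (reg s x)"
proof -
  let ?c = "Cond b (increment k) Skip"
  have body: "reg (result ?c (set_reg s' j i)) k = reg s k + card {u \<in> insert (adj i) S. P u} \<and>
      steps ?c (set_reg s' j i) \<le> bcost b + 5"
    if i: "adj i \<in> nbhd E (reg s x) - S" and S: "S \<subseteq> nbhd E (reg s x)"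
      and k: "reg s' k = reg s k + card {u \<in> S. P u}"
      and ag: "agree (insert j (written_regs ?c)) (written_arrs ?c) s s'" for S i s'
  proof -
    have "agree {j, k} {} s (set_reg s' j i)"
      using ag by (auto simp: agree_def)
    then have "bval b (set_reg s' j i) \<longleftrightarrow> P (adj i)"
      using b[of "set_reg s' j i"] i by simp
    moreover have "{u \<in> insert (adj i) S. P u}
        = (if P (adj i) then insert (adj i) {u \<in> S. P u} else {u \<in> S. P u})"
      by auto
    moreover have "finite S" using S finite_nbhd by (rule finite_subset)
    ultimately show ?thesis using i k jk by auto
  qed
  note inv = for_positions_invariant[of s x "\<lambda>S s'. reg s' k = reg s k + card {u \<in> S. P u}" j ?c
      "\<lambda>u. bcost b + 5", OF s]
  show "reg (result (for_positions j x ?c) s) k = reg s k + card {u \<in> nbhd E (reg s x). P u}"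
    by (rule inv(1)) (simp, rule body)
  have "steps (for_positions j x ?c) s \<le> 7 + (\<Sum>u\<in>nbhd E (reg s x). bcost b + 5 + 1)"
    by (rule inv(2)) (simp, rule body)
  then show "steps (for_positions j x ?c) s \<le> 7 + (bcost b + 6) * deg E (reg s x)"
    by (simp add: deg_def algebra_simps)
qed

end

section \<open>The program\<close>

context graph_input
begin

text \<open>Keeps the simplifier from turning \<open>Const 1\<close> inside programs into \<open>Const (Suc 0)\<close>.\<close>

declare One_nat_def [simp del]

definition ready :: "state \<Rightarrow> bool" where
  "ready s \<longleftrightarrow> represents s \<and> (\<forall>v<n. arr s ''deg'' v = deg E v)"

lemma ready_agree:
  assumes "agree R A s s'" "ready s" "''n'' \<notin> R" "''off'' \<notin> A" "''adj'' \<notin> A" "''deg'' \<notin> A"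
  shows "ready s'"
  using assms by (simp add: ready_def represents_def agree_def)

lemma ready_result:
  assumes "ready s" "''n'' \<notin> written_regs c"
    and "''off'' \<notin> written_arrs c" "''adj'' \<notin> written_arrs c" "''deg'' \<notin> written_arrs c"
  shows "ready (result c s)"
  using ready_agree[OF result_agree] assms by blast

lemma readyD:
  assumes "ready s"
  shows "represents s" "reg s ''n'' = n" "\<And>v. v < n \<Longrightarrow> arr s ''deg'' v = deg E v"
    "arr s ''off'' = off" "arr s ''adj'' = adj"
  using assms by (auto simp: ready_def represents_def)

lemma deg_off: "v < n \<Longrightarrow> off (Suc v) - off v = deg E v"
  using bij_betw_same_card[OF adj_bij] by (simp add: deg_def)

section \<open>Degrees and the spider test\<close>

lemma compute_degrees_spec:
  assumes s: "represents s"
  shows "ready (result compute_degrees s)"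
    and "steps compute_degrees s \<le> 3 + 11 * n"
proof -
  let ?c = "Write ''deg'' (Reg ''v'')
     (Sub (Read ''off'' (Add (Reg ''v'') (Const 1))) (Read ''off'' (Reg ''v'')))"
  let ?I = "\<lambda>v s'. \<forall>u<v. arr s' ''deg'' u = deg E u"
  have body: "?I (Suc v) (result ?c (set_reg s' ''v'' v)) \<and> steps ?c (set_reg s' ''v'' v) \<le> 10"
    if v: "v < n" and I: "?I v s'"
      and ag: "agree (insert ''v'' (written_regs ?c)) (written_arrs ?c) s s'" for v s'
    using v I represents_simps[OF s] agree_arr[OF ag, of "''off''"] deg_off[OF v]
    by (auto simp: less_Suc_eq One_nat_def)
  note inv = for_vertices_invariant[of s ?I "''v''" ?c "\<lambda>_. 10"]
  have "?I n (result compute_degrees s)"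
    unfolding compute_degrees_def
    by (rule inv(1)) (use represents_simps[OF s] body in auto)
  moreover have "represents (result compute_degrees s)"
    by (rule represents_agree[OF result_agree s]) (simp_all add: compute_degrees_def)
  ultimately show "ready (result compute_degrees s)" by (simp add: ready_def)
  have "steps compute_degrees s \<le> 3 + (\<Sum>v<n. 10 + 1)"
    unfolding compute_degrees_def
    by (rule inv(2)) (use represents_simps[OF s] body in auto)
  then show "steps compute_degrees s \<le> 3 + 11 * n" by simp
qed

lemma count_nonleaves:
  assumes s: "ready s" "reg s ''csize'' = 0"
  defines "c \<equiv> Cond (Eq (Read ''deg'' (Reg ''v'')) (Const 1)) Skip (increment ''csize'')"
  shows "reg (result (for_vertices ''v'' c) s) ''csize'' = card {v \<in> {..<n}. deg E v \<noteq> 1}"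
    and "steps (for_vertices ''v'' c) s \<le> 3 + 10 * n"
proof -
  let ?I = "\<lambda>v s'. reg s' ''csize'' = card {u \<in> {..<v}. deg E u \<noteq> 1}"
  have body: "?I (Suc v) (result c (set_reg s' ''v'' v)) \<and> steps c (set_reg s' ''v'' v) \<le> 9"
    if v: "v < n" and I: "?I v s'"
      and ag: "agree (insert ''v'' (written_regs c)) (written_arrs c) s s'" for v s'
  proof -
    have "arr s' ''deg'' v = deg E v"
      using readyD(3)[OF s(1) v] agree_arr[OF ag] by (simp add: c_def)
    moreover have "{u \<in> {..<Suc v}. deg E u \<noteq> 1}
        = (if deg E v = 1 then {u \<in> {..<v}. deg E u \<noteq> 1}
           else insert v {u \<in> {..<v}. deg E u \<noteq> 1})"
      by (auto simp: less_Suc_eq)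
    ultimately show ?thesis using I by (simp add: c_def)
  qed
  note inv = for_vertices_invariant[of s ?I "''v''" c "\<lambda>_. 9"]
  show "?I n (result (for_vertices ''v'' c) s)"
    by (rule inv(1)) (use readyD[OF s(1)] s(2) body in auto)
  have "steps (for_vertices ''v'' c) s \<le> 3 + (\<Sum>v<n. 9 + 1)"
    by (rule inv(2)) (use readyD[OF s(1)] s(2) body in auto)
  then show "steps (for_vertices ''v'' c) s \<le> 3 + 10 * n" by simp
qed

definition spider_vertex :: "nat \<Rightarrow> bool" where
  "spider_vertex v \<longleftrightarrow>
     (if deg E v = 1 then card {u \<in> nbhd E v. deg E u = 1} = 0
      else card {u \<in> nbhd E v. deg E u = 1} = 1 \<and> deg E v = card {u \<in> {..<n}. deg E u \<noteq> 1})"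

lemma check_spider_vertices:
  assumes s: "ready s" "reg s ''spider'' = 1"
    "reg s ''csize'' = card {v \<in> {..<n}. deg E v \<noteq> 1}"
  defines "c \<equiv>
       Assign ''k'' (Const 0) ;;
       for_positions ''j'' ''v''
         (Cond (Eq (Read ''deg'' (Read ''adj'' (Reg ''j''))) (Const 1)) (increment ''k'') Skip) ;;
       Cond (Eq (Read ''deg'' (Reg ''v'')) (Const 1))
         (Cond (Eq (Reg ''k'') (Const 0)) Skip (Assign ''spider'' (Const 0)))
         (Cond (And (Eq (Reg ''k'') (Const 1)) (Eq (Read ''deg'' (Reg ''v'')) (Reg ''csize'')))
            Skip (Assign ''spider'' (Const 0)))"
  shows "reg (result (for_vertices ''v'' c) s) ''spider'' = 1 \<longleftrightarrow> is_leaf_spider {..<n} E"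
    and "steps (for_vertices ''v'' c) s \<le> 3 + 30 * n + 22 * card E"
proof -
  \<comment> \<open>The flag is only ever lowered, so it records whether all vertices so far have
    passed.\<close>
  let ?I = "\<lambda>v s'. reg s' ''spider'' = 1 \<longleftrightarrow> (\<forall>u<v. spider_vertex u)"
  let ?b = "Eq (Read ''deg'' (Read ''adj'' (Reg ''j''))) (Const 1)"
  let ?loop = "for_positions ''j'' ''v'' (Cond ?b (increment ''k'') Skip)"
  let ?c1 = "Assign ''k'' (Const 0)"
  let ?c3 = "Cond (Eq (Read ''deg'' (Reg ''v'')) (Const 1))
         (Cond (Eq (Reg ''k'') (Const 0)) Skip (Assign ''spider'' (Const 0)))
         (Cond (And (Eq (Reg ''k'') (Const 1)) (Eq (Read ''deg'' (Reg ''v'')) (Reg ''csize'')))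
            Skip (Assign ''spider'' (Const 0)))"
  \<comment> \<open>The rate \<open>11\<close> is \<open>bcost ?b + 6\<close> with
    \<open>bcost ?b = 5\<close>; the constant \<open>29\<close> has slack.\<close>
  have body: "?I (Suc v) (result c (set_reg s' ''v'' v)) \<and>
      steps c (set_reg s' ''v'' v) \<le> 29 + 11 * deg E v"
    if v: "v < n" and I: "?I v s'"
      and ag: "agree (insert ''v'' (written_regs c)) (written_arrs c) s s'" for v s'
  proof -
    define s1 where "s1 = set_reg (set_reg s' ''v'' v) ''k'' 0"
    have ag1: "agree {''v'', ''k'', ''j'', ''spider''} {} s s1"
      using ag by (auto simp: agree_def s1_def c_def)
    have s1: "ready s1" "reg s1 ''v'' = v" "reg s1 ''k'' = 0" "reg s1 ''spider'' = reg s' ''spider''"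
      "reg s1 ''csize'' = reg s ''csize''"
      using ready_agree[OF ag1 s(1)] agree_reg[OF ag1] by (auto simp: s1_def)
    have b: "bval ?b t \<longleftrightarrow> deg E (adj (reg t ''j'')) = 1"
      if t: "agree {''j'', ''k''} {} s1 t" and "adj (reg t ''j'') \<in> nbhd E (reg s1 ''v'')" for t
      using that readyD[OF ready_agree[OF t s1(1)]] nbhd_less by auto
    define s2 where "s2 = result ?loop s1"
    have ag2: "agree {''j'', ''k''} {} s1 s2"
      using result_agree[of ?loop s1] by (simp add: s2_def)
    have s2: "reg s2 ''v'' = v" "reg s2 ''spider'' = reg s' ''spider''"
      "reg s2 ''csize'' = card {v \<in> {..<n}. deg E v \<noteq> 1}" "arr s2 ''deg'' v = deg E v"
      using agree_reg[OF ag2] s1 s(3) readyD(3)[OF ready_agree[OF ag2 s1(1)]] v by auto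
    have k: "reg s2 ''k'' = card {u \<in> nbhd E v. deg E u = 1}"
      "steps ?loop s1 \<le> 7 + 11 * deg E v"
      using count_positions[of s1 "''v''" "''j''" "''k''" ?b "\<lambda>u. deg E u = 1", OF readyD(1)[OF s1(1)] _ _ b]
        s1 v by (simp_all add: s2_def)
    have eq: "result ?c1 (set_reg s' ''v'' v) = s1" by (simp add: s1_def)
    have res: "result c (set_reg s' ''v'' v) = result ?c3 s2"
      by (simp only: c_def result_simps(3) eq s2_def)
    have "reg (result ?c3 s2) ''spider'' = (if spider_vertex v then reg s' ''spider'' else 0)"
      using k(1) s2 by (simp add: spider_vertex_def)
    then have 1: "?I (Suc v) (result c (set_reg s' ''v'' v))"
      unfolding res using I by (simp add: All_less_Suc)
    have "steps c (set_reg s' ''v'' v)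
        = steps ?c1 (set_reg s' ''v'' v) + (steps ?loop s1 + steps ?c3 s2)"
      by (simp only: c_def steps_simps(3) eq s2_def)
    also have "\<dots> \<le> 2 + (steps ?loop s1 + 18)"
      by (intro add_mono) simp_all
    finally have "steps c (set_reg s' ''v'' v) \<le> 20 + steps ?loop s1" by simp
    with 1 k(2) show ?thesis by simp
  qed
  note inv = for_vertices_invariant[of s ?I "''v''" c "\<lambda>v. 29 + 11 * deg E v"]
  have "?I n (result (for_vertices ''v'' c) s)"
    by (rule inv(1)) (use readyD[OF s(1)] s(2) in simp, use s(2) in simp, rule body)
  then show "reg (result (for_vertices ''v'' c) s) ''spider'' = 1 \<longleftrightarrow> is_leaf_spider {..<n} E"
    unfolding leaf_spider_iff spider_vertex_def by auto
  have "steps (for_vertices ''v'' c) s \<le> 3 + (\<Sum>v<n. 29 + 11 * deg E v + 1)"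
    by (rule inv(2)) (use readyD[OF s(1)] s(2) in simp, use s(2) in simp, rule body)
  also have "\<dots> = 3 + (\<Sum>v<n. 30 + 11 * deg E v)" by simp
  also have "\<dots> \<le> 3 + (30 * n + 2 * 11 * card E)" by (intro add_left_mono sum_le_size)
  finally show "steps (for_vertices ''v'' c) s \<le> 3 + 30 * n + 22 * card E" by simp
qed

lemma test_spider_spec:
  assumes s: "ready s"
  shows "reg (result test_spider s) ''spider'' = 1 \<longleftrightarrow> is_leaf_spider {..<n} E"
    and "ready (result test_spider s)"
    and "steps test_spider s \<le> 10 + 40 * n + 22 * card E"
proof -
  let ?c = "Cond (Eq (Read ''deg'' (Reg ''v'')) (Const 1)) Skip (increment ''csize'')"
  define s1 where "s1 = set_reg s ''csize'' 0"
  have s1: "ready s1" "reg s1 ''csize'' = 0"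
    using ready_agree[OF agree_set_reg[of _ "{''csize''}" "{}"] s] by (auto simp: s1_def)
  define s2 where "s2 = result (for_vertices ''v'' ?c) s1"
  have "ready s2"
    unfolding s2_def by (rule ready_result[OF s1(1)]) simp_all
  define s3 where "s3 = set_reg s2 ''spider'' 1"
  have s3: "ready s3" "reg s3 ''spider'' = 1" "reg s3 ''csize'' = card {v \<in> {..<n}. deg E v \<noteq> 1}"
    using ready_agree[OF agree_set_reg[of _ "{''spider''}" "{}"] \<open>ready s2\<close>] count_nonleaves[OF s1]
    by (auto simp: s3_def s2_def)
  show "reg (result test_spider s) ''spider'' = 1 \<longleftrightarrow> is_leaf_spider {..<n} E"
    using check_spider_vertices(1)[OF s3]
    by (simp add: test_spider_def s1_def[symmetric] s2_def[symmetric] s3_def[symmetric])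
  show "ready (result test_spider s)"
    by (rule ready_result[OF s]) (simp_all add: test_spider_def)
  show "steps test_spider s \<le> 10 + 40 * n + 22 * card E"
    using check_spider_vertices(2)[OF s3] count_nonleaves(2)[OF s1]
    by (simp add: test_spider_def s1_def[symmetric] s2_def[symmetric] s3_def[symmetric])
qed

lemma output_set_spec:
  assumes s: "ready s"
    and b: "\<And>s'. agree {''v'', ''status''} {''out''} s s' \<Longrightarrow> reg s' ''v'' < n
      \<Longrightarrow> bval b s' \<longleftrightarrow> P (reg s' ''v'')"
  shows "program_outcome n (result (output_set b) s) = Output {v. v < n \<and> P v}"
    and "steps (output_set b) s \<le> 5 + (bcost b + 5) * n"
proof -
  let ?c = "Cond b (Write ''out'' (Reg ''v'') (Const 1)) (Write ''out'' (Reg ''v'') (Const 0))"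
  \<comment> \<open>Zeros have to be written as well, since \<open>out\<close> starts with arbitrary
    contents.\<close>
  let ?I = "\<lambda>v s'. \<forall>u<v. arr s' ''out'' u = (if P u then 1 else 0)"
  define s1 where "s1 = set_reg s ''status'' 0"
  have ag1: "agree {''v'', ''status''} {''out''} s s1"
    by (simp add: s1_def agree_set_reg)
  have s1: "reg s1 ''n'' = n" "reg s1 ''status'' = 0"
    using readyD[OF s] by (auto simp: s1_def)
  have body: "?I (Suc v) (result ?c (set_reg s' ''v'' v)) \<and> steps ?c (set_reg s' ''v'' v) \<le> bcost b + 4"
    if v: "v < n" and I: "?I v s'"
      and ag: "agree (insert ''v'' (written_regs ?c)) (written_arrs ?c) s1 s'" for v s'
  proof -
    have "agree {''v'', ''status''} {''out''} s1 (set_reg s' ''v'' v)"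
      using ag by (auto simp: agree_def)
    then have "bval b (set_reg s' ''v'' v) \<longleftrightarrow> P v"
      using b[OF agree_trans[OF ag1]] v by simp
    then show ?thesis using I by (auto simp: less_Suc_eq)
  qed
  note inv = for_vertices_invariant[of s1 ?I "''v''" ?c "\<lambda>_. bcost b + 4"]
  define s2 where "s2 = result (for_vertices ''v'' ?c) s1"
  have "?I n s2"
    unfolding s2_def by (rule inv(1)) (use s1 body in auto)
  moreover have "reg s2 ''status'' = 0"
    using agree_reg[OF result_agree[of "for_vertices ''v'' ?c" s1], of "''status''"] s1
    by (simp add: s2_def)
  ultimately have "program_outcome n s2 = Output {v. v < n \<and> P v}"
    by (auto simp: program_outcome_def split: if_splits)
  then show "program_outcome n (result (output_set b) s) = Output {v. v < n \<and> P v}"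
    by (simp add: output_set_def s1_def[symmetric] s2_def[symmetric])
  have "steps (for_vertices ''v'' ?c) s1 \<le> 3 + (\<Sum>v<n. bcost b + 4 + 1)"
    by (rule inv(2)) (use s1 body in auto)
  then show "steps (output_set b) s \<le> 5 + (bcost b + 5) * n"
    by (simp add: output_set_def s1_def[symmetric] algebra_simps)
qed

section \<open>Choosing and testing the two vertices\<close>

lemma choose_first_spec:
  assumes s: "ready s" and n: "n > 0"
  shows "min_degree_in E {..<n} (reg (result choose_first s) ''d'')"
    and "ready (result choose_first s)"
    and "steps choose_first s \<le> 5 + 10 * n"
proof -
  let ?c = "Cond (Less (Read ''deg'' (Reg ''v'')) (Read ''deg'' (Reg ''d'')))
       (Assign ''d'' (Reg ''v'')) Skip"
  \<comment> \<open>The bound \<open>d < n\<close> ensures that the entry \<open>deg[d]\<close> is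
    meaningful; for the initial candidate \<open>0\<close> it is the assumption
    \<open>n > 0\<close>.\<close>
  let ?I = "\<lambda>v s'. reg s' ''d'' < n \<and> (\<forall>u<v. deg E (reg s' ''d'') \<le> deg E u)"
  define s1 where "s1 = set_reg s ''d'' 0"
  have s1: "ready s1" "reg s1 ''d'' = 0"
    using ready_agree[OF agree_set_reg[of _ "{''d''}" "{}"] s] by (auto simp: s1_def)
  have body: "?I (Suc v) (result ?c (set_reg s' ''v'' v)) \<and> steps ?c (set_reg s' ''v'' v) \<le> 9"
    if v: "v < n" and I: "?I v s'"
      and ag: "agree (insert ''v'' (written_regs ?c)) (written_arrs ?c) s1 s'" for v s'
  proof -
    have "arr s' ''deg'' u = deg E u" if "u < n" for u
      using readyD(3)[OF s1(1) that] agree_arr[OF ag] by simp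
    then show ?thesis using v I by (auto simp: less_Suc_eq intro: order.strict_implies_order
          dest: order.strict_trans2)
  qed
  note inv = for_vertices_invariant[of s1 ?I "''v''" ?c "\<lambda>_. 9"]
  have "?I n (result (for_vertices ''v'' ?c) s1)"
    by (rule inv(1)) (use readyD[OF s1(1)] s1(2) n body in auto)
  then show "min_degree_in E {..<n} (reg (result choose_first s) ''d'')"
    by (auto simp: choose_first_def s1_def[symmetric] min_degree_in_def is_arg_min_def not_less)
  show "ready (result choose_first s)"
    by (rule ready_result[OF s]) (simp_all add: choose_first_def)
  have "steps (for_vertices ''v'' ?c) s1 \<le> 3 + (\<Sum>v<n. 9 + 1)"
    by (rule inv(2)) (use readyD[OF s1(1)] s1(2) n body in auto)
  then show "steps choose_first s \<le> 5 + 10 * n"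
    by (simp add: choose_first_def s1_def[symmetric])
qed

text \<open>Marks are arbitrary at the start, and the test of the second vertex must not see those
  of the first.\<close>

lemma clear_marks:
  assumes s: "reg s ''n'' = n"
  defines "c \<equiv> Write ''mark'' (Reg ''v'') (Const 0)"
  shows "\<forall>u<n. arr (result (for_vertices ''v'' c) s) ''mark'' u = 0"
    and "steps (for_vertices ''v'' c) s \<le> 3 + 4 * n"
proof -
  let ?I = "\<lambda>v s'. \<forall>u<v. arr s' ''mark'' u = 0"
  have body: "?I (Suc v) (result c (set_reg s' ''v'' v)) \<and> steps c (set_reg s' ''v'' v) \<le> 3"
    if "?I v s'" for v s'
    using that by (auto simp: c_def less_Suc_eq)
  note inv = for_vertices_invariant[of s ?I "''v''" c "\<lambda>_. 3"]
  show "?I n (result (for_vertices ''v'' c) s)"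
    by (rule inv(1)) (use s body in auto)
  have "steps (for_vertices ''v'' c) s \<le> 3 + (\<Sum>v<n. 3 + 1)"
    by (rule inv(2)) (use s body in auto)
  then show "steps (for_vertices ''v'' c) s \<le> 3 + 4 * n" by simp
qed

lemma set_marks:
  assumes s: "represents s" "reg s x < n" "\<forall>u<n. arr s ''mark'' u = 0"
  defines "c \<equiv> Write ''mark'' (Read ''adj'' (Reg ''i'')) (Const 1)"
  shows "\<forall>u<n. arr (result (for_positions ''i'' x c) s) ''mark'' u
      = (if u \<in> nbhd E (reg s x) then 1 else 0)"
    and "steps (for_positions ''i'' x c) s \<le> 7 + 6 * n"
proof -
  let ?I = "\<lambda>S s'. \<forall>u<n. arr s' ''mark'' u = (if u \<in> S then 1 else 0)"
  have body: "?I (insert (adj i) S) (result c (set_reg s' ''i'' i)) \<and> steps c (set_reg s' ''i'' i) \<le> 5"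
    if "adj i \<in> nbhd E (reg s x) - S" "S \<subseteq> nbhd E (reg s x)" and I: "?I S s'"
      and ag: "agree (insert ''i'' (written_regs c)) (written_arrs c) s s'" for S i s'
    using I represents_simps[OF s(1)] agree_arr[OF ag, of "''adj''"] by (auto simp: c_def)
  note inv = for_positions_invariant[of s x ?I "''i''" c "\<lambda>_. 5", OF s(1,2)]
  show "?I (nbhd E (reg s x)) (result (for_positions ''i'' x c) s)"
    by (rule inv(1)) (use s(3) in simp, rule body)
  have "steps (for_positions ''i'' x c) s \<le> 7 + (\<Sum>u\<in>nbhd E (reg s x). 5 + 1)"
    by (rule inv(2)) (use s(3) in simp, rule body)
  also have "\<dots> \<le> 7 + 6 * n"
    using card_mono[OF finite_V nbhd_subset[of "reg s x"]] by simp
  finally show "steps (for_positions ''i'' x c) s \<le> 7 + 6 * n" .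
qed

text \<open>Linear because each adjacency list is scanned at most once: the outer loop visits
  distinct neighbours of \<open>x\<close>. The condition on the name \<open>x\<close> keeps that
  register intact during the loop.\<close>

lemma check_marked_clique:
  assumes s: "ready s" "reg s x < n" "reg s ''q'' = 1"
    "\<forall>u<n. arr s ''mark'' u = (if u \<in> nbhd E (reg s x) then 1 else 0)"
    and x: "x \<notin> {''i'', ''j'', ''k'', ''q'', ''u''}"
  defines "c \<equiv>
       Assign ''u'' (Read ''adj'' (Reg ''i'')) ;;
       Assign ''k'' (Const 0) ;;
       for_positions ''j'' ''u''
         (Cond (Eq (Read ''mark'' (Read ''adj'' (Reg ''j''))) (Const 1)) (increment ''k'') Skip) ;;
       Cond (Eq (Add (Reg ''k'') (Const 1)) (Read ''deg'' (Reg x))) Skip (Assign ''q'' (Const 0))"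
  shows "reg (result (for_positions ''i'' x c) s) ''q''
      = (if clique E (nbhd E (reg s x)) then 1 else 0)"
    and "steps (for_positions ''i'' x c) s \<le> 7 + 22 * n + 22 * card E"
proof -
  let ?N = "nbhd E (reg s x)"
  define P where "P u \<longleftrightarrow> card {w \<in> nbhd E u. w \<in> ?N} + 1 = deg E (reg s x)" for u
  let ?I = "\<lambda>S s'. reg s' ''q'' = (if \<forall>u\<in>S. P u then 1 else 0)"
  let ?b = "Eq (Read ''mark'' (Read ''adj'' (Reg ''j''))) (Const 1)"
  let ?loop = "for_positions ''j'' ''u'' (Cond ?b (increment ''k'') Skip)"
  let ?c1 = "Assign ''u'' (Read ''adj'' (Reg ''i''))"
  let ?c2 = "Assign ''k'' (Const 0)"
  let ?c4 = "Cond (Eq (Add (Reg ''k'') (Const 1)) (Read ''deg'' (Reg x))) Skip (Assign ''q'' (Const 0))"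
  have body: "?I (insert (adj i) S) (result c (set_reg s' ''i'' i)) \<and>
      steps c (set_reg s' ''i'' i) \<le> 21 + 11 * deg E (adj i)"
    if i: "adj i \<in> ?N - S" and "S \<subseteq> ?N" and I: "?I S s'"
      and ag: "agree (insert ''i'' (written_regs c)) (written_arrs c) s s'" for i S s'
  proof -
    have adj: "arr s' ''adj'' = adj"
      using agree_arr[OF ag, of "''adj''"] readyD[OF s(1)] by (simp add: c_def)
    define s1 where "s1 = set_reg (set_reg (set_reg s' ''i'' i) ''u'' (adj i)) ''k'' 0"
    have ag1: "agree {''i'', ''j'', ''k'', ''q'', ''u''} {} s s1"
      using ag by (auto simp: agree_def s1_def c_def)
    have s1: "ready s1" "reg s1 ''u'' = adj i" "reg s1 ''k'' = 0" "reg s1 ''q'' = reg s' ''q''"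
      "reg s1 x = reg s x" "arr s1 ''mark'' = arr s ''mark''"
      using ready_agree[OF ag1 s(1)] agree_reg[OF ag1, of x] agree_arr[OF ag1] x
      by (auto simp: s1_def)
    have b: "bval ?b t \<longleftrightarrow> adj (reg t ''j'') \<in> ?N"
      if t: "agree {''j'', ''k''} {} s1 t" and "adj (reg t ''j'') \<in> nbhd E (reg s1 ''u'')" for t
      using that readyD[OF ready_agree[OF t s1(1)]] nbhd_less s(4) agree_arr[OF t] s1(6) by auto
    define s2 where "s2 = result ?loop s1"
    have ag2: "agree {''j'', ''k''} {} s1 s2"
      using result_agree[of ?loop s1] by (simp add: s2_def)
    have s2: "reg s2 x = reg s x" "reg s2 ''q'' = reg s' ''q''"
      "arr s2 ''deg'' (reg s x) = deg E (reg s x)"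
      using agree_reg[OF ag2] s1 x readyD(3)[OF ready_agree[OF ag2 s1(1)]] s(2) by auto
    have "adj i < n" using i nbhd_less by blast
    then have k: "reg s2 ''k'' = card {w \<in> nbhd E (adj i). w \<in> ?N}"
      "steps ?loop s1 \<le> 7 + 11 * deg E (adj i)"
      using count_positions[of s1 "''u''" "''j''" "''k''" ?b "\<lambda>w. w \<in> ?N", OF readyD(1)[OF s1(1)] _ _ b]
        s1 by (simp_all add: s2_def)
    have eq: "result ?c2 (result ?c1 (set_reg s' ''i'' i)) = s1"
      by (simp add: s1_def adj)
    have res: "result c (set_reg s' ''i'' i) = result ?c4 s2"
      by (simp only: c_def result_simps(3) eq s2_def)
    have "reg (result ?c4 s2) ''q'' = (if P (adj i) then reg s' ''q'' else 0)"
      using k(1) s2 by (simp add: P_def)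
    then have 1: "?I (insert (adj i) S) (result c (set_reg s' ''i'' i))"
      unfolding res using I by simp
    have "steps c (set_reg s' ''i'' i) = steps ?c1 (set_reg s' ''i'' i)
        + (steps ?c2 (result ?c1 (set_reg s' ''i'' i)) + (steps ?loop s1 + steps ?c4 s2))"
      by (simp only: c_def steps_simps(3) eq s2_def)
    also have "\<dots> \<le> 3 + (2 + (steps ?loop s1 + 9))"
      by (intro add_mono) simp_all
    finally have "steps c (set_reg s' ''i'' i) \<le> 14 + steps ?loop s1" by simp
    with 1 k(2) show ?thesis by simp
  qed
  note inv = for_positions_invariant[of s x ?I "''i''" c "\<lambda>u. 21 + 11 * deg E u", OF readyD(1)[OF s(1)] s(2)]
  have "?I ?N (result (for_positions ''i'' x c) s)"
    by (rule inv(1)) (use s(3) in simp, rule body)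
  then show "reg (result (for_positions ''i'' x c) s) ''q'' = (if clique E ?N then 1 else 0)"
    by (simp add: clique_nbhd_iff P_def)
  have "steps (for_positions ''i'' x c) s \<le> 7 + (\<Sum>u\<in>?N. 21 + 11 * deg E u + 1)"
    by (rule inv(2)) (use s(3) in simp, rule body)
  also have "\<dots> \<le> 7 + (\<Sum>u<n. 21 + 11 * deg E u + 1)"
    using nbhd_subset by (intro add_left_mono sum_mono2) auto
  also have "\<dots> = 7 + (\<Sum>v<n. 22 + 11 * deg E v)" by simp
  also have "\<dots> \<le> 7 + (22 * n + 2 * 11 * card E)" by (intro add_left_mono sum_le_size)
  finally show "steps (for_positions ''i'' x c) s \<le> 7 + 22 * n + 22 * card E" by simp
qed

text \<open>The final marks are part of the result because \<open>choose_second\<close> reads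
  \<open>N(d)\<close> from them.\<close>

lemma test_clique_spec:
  assumes s: "ready s" "reg s x < n" and x: "x \<notin> {''i'', ''j'', ''k'', ''q'', ''u'', ''v''}"
  shows "reg (result (test_clique x) s) ''q'' = (if clique E (nbhd E (reg s x)) then 1 else 0)"
    and "\<forall>u<n. arr (result (test_clique x) s) ''mark'' u = (if u \<in> nbhd E (reg s x) then 1 else 0)"
    and "agree {''i'', ''j'', ''k'', ''q'', ''u'', ''v''} {''mark''} s (result (test_clique x) s)"
    and "steps (test_clique x) s \<le> 19 + 33 * n + 22 * card E"
proof -
  let ?c1 = "for_vertices ''v'' (Write ''mark'' (Reg ''v'') (Const 0))"
  let ?c2 = "for_positions ''i'' x (Write ''mark'' (Read ''adj'' (Reg ''i'')) (Const 1))"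
  let ?c3 = "for_positions ''i'' x (
       Assign ''u'' (Read ''adj'' (Reg ''i'')) ;;
       Assign ''k'' (Const 0) ;;
       for_positions ''j'' ''u''
         (Cond (Eq (Read ''mark'' (Read ''adj'' (Reg ''j''))) (Const 1)) (increment ''k'') Skip) ;;
       Cond (Eq (Add (Reg ''k'') (Const 1)) (Read ''deg'' (Reg x))) Skip (Assign ''q'' (Const 0)))"
  define s1 where "s1 = result ?c1 s"
  have ag1: "agree {''v''} {''mark''} s s1"
    using result_agree[of ?c1 s] by (simp add: s1_def)
  have s1: "ready s1" "reg s1 x = reg s x"
    using ready_agree[OF ag1 s(1)] agree_reg[OF ag1, of x] x by auto
  have m1: "\<forall>u<n. arr s1 ''mark'' u = 0" "steps ?c1 s \<le> 3 + 4 * n"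
    using clear_marks[OF readyD(2)[OF s(1)]] by (auto simp: s1_def)
  define s2 where "s2 = result ?c2 s1"
  have ag2: "agree {''i''} {''mark''} s1 s2"
    using result_agree[of ?c2 s1] by (simp add: s2_def)
  have s2: "ready s2" "reg s2 x = reg s x"
    using ready_agree[OF ag2 s1(1)] agree_reg[OF ag2, of x] x s1 by auto
  have m2: "\<forall>u<n. arr s2 ''mark'' u = (if u \<in> nbhd E (reg s x) then 1 else 0)"
    "steps ?c2 s1 \<le> 7 + 6 * n"
    using set_marks[OF readyD(1)[OF s1(1)] _ m1(1), of x] s(2) s1(2) by (auto simp: s2_def)
  define s3 where "s3 = set_reg s2 ''q'' 1"
  have s3: "ready s3" "reg s3 x < n" "reg s3 ''q'' = 1"
    "\<forall>u<n. arr s3 ''mark'' u = (if u \<in> nbhd E (reg s3 x) then 1 else 0)"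
    "reg s3 x = reg s x"
    using ready_agree[OF agree_set_reg[of _ "{''q''}" "{}"] s2(1)] s2 m2 s(2) x
    by (auto simp: s3_def)
  define s4 where "s4 = result ?c3 s3"
  have ag4: "agree {''i'', ''j'', ''k'', ''q'', ''u''} {} s3 s4"
    using result_agree[of ?c3 s3] by (simp add: s4_def insert_commute)
  have res: "result (test_clique x) s = s4"
    by (simp add: test_clique_def s1_def s2_def s3_def s4_def)
  have xs: "x \<notin> {''i'', ''j'', ''k'', ''q'', ''u''}" using x by simp
  note m3 = check_marked_clique[OF s3(1-4) xs]
  show "reg (result (test_clique x) s) ''q'' = (if clique E (nbhd E (reg s x)) then 1 else 0)"
    using m3(1) s3(5) by (simp add: res s4_def)
  show "\<forall>u<n. arr (result (test_clique x) s) ''mark'' u = (if u \<in> nbhd E (reg s x) then 1 else 0)"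
    using s3(4,5) agree_arr[OF ag4] by (simp add: res)
  show "agree {''i'', ''j'', ''k'', ''q'', ''u'', ''v''} {''mark''} s (result (test_clique x) s)"
    using ag1 ag2 ag4 by (simp add: res agree_def s3_def)
  show "steps (test_clique x) s \<le> 19 + 33 * n + 22 * card E"
    using m1(2) m2(2) m3(2)
    by (simp add: test_clique_def s1_def[symmetric] s2_def[symmetric] s3_def[symmetric])
qed

lemma choose_second_spec:
  assumes s: "ready s"
    and mark: "\<forall>u<n. arr s ''mark'' u = (if u \<in> nbhd E (reg s ''d'') then 1 else 0)"
  defines "r \<equiv> result choose_second s" and "N \<equiv> closed_nbhd E (reg s ''d'')"
  shows "reg r ''has'' = 0 \<Longrightarrow> {..<n} - N = {}"
    and "reg r ''has'' \<noteq> 0 \<Longrightarrow> min_degree_in E ({..<n} - N) (reg r ''e'')"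
    and "agree {''has'', ''e'', ''v''} {} s r"
    and "steps choose_second s \<le> 7 + 30 * n"
proof -
  let ?c = "Cond (Or (Eq (Reg ''v'') (Reg ''d'')) (Eq (Read ''mark'' (Reg ''v'')) (Const 1))) Skip
         (Cond (Or (Eq (Reg ''has'') (Const 0))
                 (Less (Read ''deg'' (Reg ''v'')) (Read ''deg'' (Reg ''e''))))
            (Assign ''e'' (Reg ''v'') ;; Assign ''has'' (Const 1))
            Skip)"
  \<comment> \<open>While \<open>has\<close> is \<open>0\<close>, the content of \<open>e\<close> is
    a mere placeholder; the first vertex outside \<open>N\<close> is accepted whatever the degree
    comparison yields.\<close>
  let ?I = "\<lambda>v s'. if reg s' ''has'' = 0 then \<forall>u<v. u \<in> N
      else reg s' ''e'' \<in> {..<n} - N \<and> (\<forall>u<v. u \<notin> N \<longrightarrow> deg E (reg s' ''e'') \<le> deg E u)"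
  define s1 where "s1 = s\<lparr>reg := (reg s)(''has'' := 0, ''e'' := 0)\<rparr>"
  have ag1: "agree {''has'', ''e'', ''v''} {} s s1"
    by (simp add: agree_def s1_def)
  have s1: "ready s1" "reg s1 ''has'' = 0"
    using ready_agree[OF ag1 s] by (auto simp: s1_def)
  have body: "?I (Suc v) (result ?c (set_reg s' ''v'' v)) \<and> steps ?c (set_reg s' ''v'' v) \<le> 29"
    if v: "v < n" and I: "?I v s'"
      and ag: "agree (insert ''v'' (written_regs ?c)) (written_arrs ?c) s1 s'" for v s'
  proof -
    have ag': "agree {''has'', ''e'', ''v''} {} s s'"
      using agree_trans[OF ag1 agree_mono[OF ag]] by auto
    have deg: "arr s' ''deg'' u = deg E u" if "u < n" for u
      using readyD(3)[OF ready_agree[OF ag' s] that] by simp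
    have "bval (Or (Eq (Reg ''v'') (Reg ''d'')) (Eq (Read ''mark'' (Reg ''v'')) (Const 1)))
        (set_reg s' ''v'' v) \<longleftrightarrow> v \<in> N"
      using v mark agree_reg[OF ag'] agree_arr[OF ag'] by (auto simp: N_def closed_nbhd_def)
    then show ?thesis
      using v I deg
      by (auto simp: less_Suc_eq split: if_splits
          intro: order.strict_implies_order dest: order.strict_trans2)
  qed
  note inv = for_vertices_invariant[of s1 ?I "''v''" ?c "\<lambda>_. 29"]
  have res: "r = result (for_vertices ''v'' ?c) s1"
    by (simp add: r_def choose_second_def s1_def)
  have I: "?I n r"
    unfolding res
    by (rule inv(1)) (use readyD[OF s1(1)] in simp, use s1(2) in simp, rule body)
  then show "reg r ''has'' = 0 \<Longrightarrow> {..<n} - N = {}" by (auto split: if_splits)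
  show "reg r ''has'' \<noteq> 0 \<Longrightarrow> min_degree_in E ({..<n} - N) (reg r ''e'')"
    using I by (auto simp: min_degree_in_def is_arg_min_def not_less split: if_splits)
  show "agree {''has'', ''e'', ''v''} {} s r"
    using agree_mono[OF result_agree[of choose_second s]] by (auto simp: r_def choose_second_def)
  have "steps (for_vertices ''v'' ?c) s1 \<le> 3 + (\<Sum>v<n. 29 + 1)"
    by (rule inv(2)) (use readyD[OF s1(1)] in simp, use s1(2) in simp, rule body)
  then show "steps choose_second s \<le> 7 + 30 * n"
    by (simp add: choose_second_def s1_def[symmetric])
qed

lemma test_pair_spec:
  assumes s: "ready s" and de: "reg s ''d'' < n" "reg s ''e'' < n"
  shows "reg (result test_pair s) ''ok'' = 1 \<longleftrightarrow>
      efficient_dominating_set {..<n} E {reg s ''d'', reg s ''e''}"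
    and "agree {''ok'', ''v'', ''k'', ''j''} {} s (result test_pair s)"
    and "steps test_pair s \<le> 5 + 40 * n + 38 * card E"
proof -
  let ?d = "reg s ''d''" and ?e = "reg s ''e''"
  let ?b = "Or (Eq (Read ''adj'' (Reg ''j'')) (Reg ''d'')) (Eq (Read ''adj'' (Reg ''j'')) (Reg ''e''))"
  let ?loop = "for_positions ''j'' ''v'' (Cond ?b (increment ''k'') Skip)"
  let ?c1 = "Assign ''k'' (Const 0)"
  let ?c2 = "Cond (Or (Eq (Reg ''v'') (Reg ''d'')) (Eq (Reg ''v'') (Reg ''e''))) (increment ''k'') Skip"
  let ?c3 = "Cond (Eq (Reg ''k'') (Const 1)) Skip (Assign ''ok'' (Const 0))"
  let ?c = "?c1 ;; ?c2 ;; ?loop ;; ?c3"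
  define P where "P v \<longleftrightarrow>
    (if v = ?d \<or> v = ?e then 1 else 0) + card {u \<in> nbhd E v. u = ?d \<or> u = ?e} = 1" for v
  let ?I = "\<lambda>v s'. reg s' ''ok'' = 1 \<longleftrightarrow> (\<forall>u<v. P u)"
  define s0 where "s0 = set_reg s ''ok'' 1"
  have ag0: "agree {''ok'', ''v'', ''k'', ''j''} {} s s0"
    by (simp add: agree_def s0_def)
  have s0: "reg s0 ''n'' = n" "reg s0 ''ok'' = 1"
    using readyD[OF s] by (auto simp: s0_def)
  have body: "?I (Suc v) (result ?c (set_reg s' ''v'' v)) \<and>
      steps ?c (set_reg s' ''v'' v) \<le> 39 + 19 * deg E v"
    if v: "v < n" and I: "?I v s'"
      and ag: "agree (insert ''v'' (written_regs ?c)) (written_arrs ?c) s0 s'" for v s'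
  proof -
    have ag': "agree {''ok'', ''v'', ''k'', ''j''} {} s s'"
      using agree_trans[OF ag0 agree_mono[OF ag]] by auto
    \<comment> \<open>The state entering the inner loop: \<open>k\<close> already holds the first
      summand of \<open>efficient_pair_iff\<close>.\<close>
    define s1 where "s1 = set_reg (set_reg s' ''v'' v) ''k'' (if v = ?d \<or> v = ?e then 1 else 0)"
    have ag1: "agree {''ok'', ''v'', ''k'', ''j''} {} s s1"
      using ag' by (auto simp: agree_def s1_def)
    have s1: "ready s1" "reg s1 ''v'' = v" "reg s1 ''k'' = (if v = ?d \<or> v = ?e then 1 else 0)"
      "reg s1 ''ok'' = reg s' ''ok''" "reg s1 ''d'' = ?d" "reg s1 ''e'' = ?e"
      using ready_agree[OF ag1 s] agree_reg[OF ag1] by (auto simp: s1_def)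
    have b: "bval ?b t \<longleftrightarrow> adj (reg t ''j'') = ?d \<or> adj (reg t ''j'') = ?e"
      if t: "agree {''j'', ''k''} {} s1 t" for t
      using readyD[OF ready_agree[OF t s1(1)]] agree_reg[OF t] s1 by auto
    define s2 where "s2 = result ?loop s1"
    have ag2: "agree {''j'', ''k''} {} s1 s2"
      using result_agree[of ?loop s1] by (simp add: s2_def)
    have k: "reg s2 ''k'' = (if v = ?d \<or> v = ?e then 1 else 0)
        + card {u \<in> nbhd E v. u = ?d \<or> u = ?e}"
      "steps ?loop s1 \<le> 7 + 19 * deg E v"
      using count_positions[of s1 "''v''" "''j''" "''k''" ?b "\<lambda>u. u = ?d \<or> u = ?e",
          OF readyD(1)[OF s1(1)] _ _ b] s1 v by (simp_all add: s2_def)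
    have eq: "result ?c2 (result ?c1 (set_reg s' ''v'' v)) = s1"
      using agree_reg[OF ag'] by (auto simp: s1_def)
    have ok2: "reg s2 ''ok'' = reg s' ''ok''" using agree_reg[OF ag2] s1 by simp
    have res: "result ?c (set_reg s' ''v'' v) = result ?c3 s2"
      by (simp only: result_simps(3) eq s2_def)
    have "reg (result ?c3 s2) ''ok'' = (if P v then reg s' ''ok'' else 0)"
      using k(1) ok2 by (simp add: P_def)
    then have 1: "?I (Suc v) (result ?c (set_reg s' ''v'' v))"
      unfolding res using I by (simp add: All_less_Suc)
    have "steps ?c (set_reg s' ''v'' v) = steps ?c1 (set_reg s' ''v'' v)
        + (steps ?c2 (result ?c1 (set_reg s' ''v'' v)) + (steps ?loop s1 + steps ?c3 s2))"
      by (simp only: steps_simps(3) eq s2_def)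
    also have "\<dots> \<le> 2 + (12 + (steps ?loop s1 + 6))"
      by (intro add_mono) simp_all
    finally have "steps ?c (set_reg s' ''v'' v) \<le> 20 + steps ?loop s1" by simp
    with 1 k(2) show ?thesis by simp
  qed
  note inv = for_vertices_invariant[of s0 ?I "''v''" ?c "\<lambda>v. 39 + 19 * deg E v"]
  have res0: "result test_pair s = result (for_vertices ''v'' ?c) s0"
    by (simp add: test_pair_def s0_def)
  have "?I n (result test_pair s)"
    unfolding res0 by (rule inv(1)) (use s0 in simp, use s0 in simp, rule body)
  then show "reg (result test_pair s) ''ok'' = 1 \<longleftrightarrow> efficient_dominating_set {..<n} E {?d, ?e}"
    using efficient_pair_iff[of ?d ?e] de by (simp add: P_def Ball_def)
  show "agree {''ok'', ''v'', ''k'', ''j''} {} s (result test_pair s)"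
    using agree_mono[OF result_agree[of test_pair s]] by (auto simp: test_pair_def)
  have "steps (for_vertices ''v'' ?c) s0 \<le> 3 + (\<Sum>v<n. 39 + 19 * deg E v + 1)"
    by (rule inv(2)) (use s0 in simp, use s0 in simp, rule body)
  also have "\<dots> = 3 + (\<Sum>v<n. 40 + 19 * deg E v)" by simp
  also have "\<dots> \<le> 3 + (40 * n + 2 * 19 * card E)" by (intro add_left_mono sum_le_size)
  finally show "steps test_pair s \<le> 5 + 40 * n + 38 * card E"
    by (simp add: test_pair_def s0_def[symmetric])
qed

text \<open>The branches of the program match the six rules of \<open>ED\<close> one by one; all
  graph theory is left to \<open>ED_correct\<close>.\<close>

lemma ED_program_spec:
  assumes s: "represents s"
  shows "ED {..<n} E (program_outcome n (result ED_program s))"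
    and "steps ED_program s \<le> 200 + 300 * n + 150 * card E"
proof -
  let ?b1 = "Eq (Read ''deg'' (Reg ''v'')) (Const 1)"
  let ?b2 = "Eq (Reg ''v'') (Reg ''d'')"
  let ?b3 = "Or (Eq (Reg ''v'') (Reg ''d'')) (Eq (Reg ''v'') (Reg ''e''))"
  \<comment> \<open>\<open>?p3\<close> to \<open>?p7\<close> are the nested remainders of the
    program. Each gets a time budget with slack, covering the next phase, the branch test and the
    budget of the following remainder.\<close>
  let ?p7 = "Cond (Eq (Reg ''ok'') (Const 1)) (output_set ?b3) (Assign ''status'' (Const 2))"
  let ?p6 = "Cond (Eq (Reg ''q'') (Const 0)) (Assign ''status'' (Const 1)) (test_pair ;; ?p7)"
  let ?p5 = "Cond (Eq (Reg ''has'') (Const 0)) (output_set ?b2) (test_clique ''e'' ;; ?p6)"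
  let ?p4 = "Cond (Eq (Reg ''q'') (Const 0)) (Assign ''status'' (Const 1)) (choose_second ;; ?p5)"
  let ?p3 = "Cond (Eq (Reg ''spider'') (Const 1)) (output_set ?b1)
    (choose_first ;; test_clique ''d'' ;; ?p4)"
  let ?ED = "\<lambda>r. ED {..<n} E (program_outcome n r)"
  define s1 where "s1 = result compute_degrees s"
  define s2 where "s2 = result test_spider s1"
  have s1: "ready s1" "steps compute_degrees s \<le> 3 + 11 * n"
    using compute_degrees_spec[OF s] by (simp_all add: s1_def)
  have s2: "ready s2" "steps test_spider s1 \<le> 10 + 40 * n + 22 * card E"
    "reg s2 ''spider'' = 1 \<longleftrightarrow> is_leaf_spider {..<n} E"
    using test_spider_spec[OF s1(1)] by (simp_all add: s2_def)
  have res: "result ED_program s = result ?p3 s2"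
    "steps ED_program s = steps compute_degrees s + (steps test_spider s1 + steps ?p3 s2)"
    by (simp_all only: ED_program_def result_simps(3) steps_simps(3) s1_def s2_def)
  have "?ED (result ?p3 s2) \<and> steps ?p3 s2 \<le> 150 + 230 * n + 120 * card E"
  proof (cases "is_leaf_spider {..<n} E")
    case spider: True
    have b: "bval ?b1 t \<longleftrightarrow> deg E (reg t ''v'') = 1"
      if t: "agree {''v'', ''status''} {''out''} s2 t" and "reg t ''v'' < n" for t
      using readyD(3)[OF ready_agree[OF t s2(1)]] that by simp
    have "program_outcome n (result ?p3 s2) = Output (leaves {..<n} E)"
      using output_set_spec(1)[OF s2(1), of ?b1 "\<lambda>v. deg E v = 1", OF b] spider s2(3)
      by (simp add: leaves_def)
    moreover have "steps (output_set ?b1) s2 \<le> 5 + 9 * n"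
      using output_set_spec(2)[OF s2(1), of ?b1 "\<lambda>v. deg E v = 1", OF b] by simp
    ultimately show ?thesis using ED.spider[OF spider] spider s2(3) by simp
  next
    case spider: False
    \<comment> \<open>For \<open>n = 0\<close> the criterion for spiders holds vacuously.\<close>
    then have n: "n > 0" by (auto simp: leaf_spider_iff)
    define s3 where "s3 = result choose_first s2"
    define d where "d = reg s3 ''d''"
    have s3: "ready s3" "min_degree_in E {..<n} d" "steps choose_first s2 \<le> 5 + 10 * n"
      using choose_first_spec[OF s2(1) n] by (simp_all add: s3_def d_def)
    have d: "d < n" using s3(2) by (simp add: min_degree_in_def is_arg_min_def)
    define s4 where "s4 = result (test_clique ''d'') s3"
    note tc = test_clique_spec[OF s3(1), of "''d''", folded s4_def d_def, OF d]
    have ag4: "agree {''i'', ''j'', ''k'', ''q'', ''u'', ''v''} {''mark''} s3 s4"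
      using tc(3) by simp
    have s4: "ready s4" "reg s4 ''d'' = d" "reg s4 ''q'' = (if clique E (nbhd E d) then 1 else 0)"
      "\<forall>u<n. arr s4 ''mark'' u = (if u \<in> nbhd E (reg s4 ''d'') then 1 else 0)"
      "steps (test_clique ''d'') s3 \<le> 19 + 33 * n + 22 * card E"
      using ready_agree[OF ag4 s3(1)] agree_reg[OF ag4, of "''d''"] tc by (simp_all add: d_def)
    have "?ED (result ?p4 s4) \<and> steps ?p4 s4 \<le> 100 + 180 * n + 90 * card E"
    proof (cases "clique E (nbhd E d)")
      case False
      then have "program_outcome n (result ?p4 s4) = Stop"
        using s4(3) by (simp add: program_outcome_def)
      then show ?thesis
        using ED.stop1[OF spider s3(2) False] s4(3) False by simp
    next
      case clique: True
      define s5 where "s5 = result choose_second s4"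
      note cs = choose_second_spec[OF s4(1,4), folded s5_def, unfolded s4(2)]
      have s5: "ready s5" "reg s5 ''d'' = d"
        using ready_agree[OF cs(3) s4(1)] agree_reg[OF cs(3)] s4(2) by simp_all
      have "?ED (result ?p5 s5) \<and> steps ?p5 s5 \<le> 80 + 140 * n + 90 * card E"
      proof (cases "reg s5 ''has'' = 0")
        case True
        have b: "bval ?b2 t \<longleftrightarrow> reg t ''v'' = d"
          if t: "agree {''v'', ''status''} {''out''} s5 t" for t
          using agree_reg[OF t, of "''d''"] s5(2) by simp
        have "{v. v < n \<and> v = d} = {d}" using d by auto
        then have "program_outcome n (result ?p5 s5) = Output {d}"
          using output_set_spec(1)[OF s5(1), of ?b2 "\<lambda>v. v = d", OF b] True by simp
        moreover have "steps (output_set ?b2) s5 \<le> 5 + 8 * n"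
          using output_set_spec(2)[OF s5(1), of ?b2 "\<lambda>v. v = d", OF b] by simp
        ultimately show ?thesis
          using ED.universal[OF spider s3(2) clique cs(1)[OF True]] True by simp
      next
        case False
        define e where "e = reg s5 ''e''"
        have e: "min_degree_in E ({..<n} - closed_nbhd E d) e"
          using cs(2)[OF False] by (simp add: e_def)
        then have "e < n" by (simp add: min_degree_in_def is_arg_min_def)
        define s6 where "s6 = result (test_clique ''e'') s5"
        note tc' = test_clique_spec[OF s5(1), of "''e''", folded s6_def e_def, OF \<open>e < n\<close>]
        have ag6: "agree {''i'', ''j'', ''k'', ''q'', ''u'', ''v''} {''mark''} s5 s6"
          using tc'(3) by simp
        have s6: "ready s6" "reg s6 ''d'' = d" "reg s6 ''e'' = e"
          "reg s6 ''q'' = (if clique E (nbhd E e) then 1 else 0)"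
          "steps (test_clique ''e'') s5 \<le> 19 + 33 * n + 22 * card E"
          using ready_agree[OF ag6 s5(1)] agree_reg[OF ag6, of "''d''"] agree_reg[OF ag6, of "''e''"]
            tc' s5(2) by (simp_all add: e_def)
        have "?ED (result ?p6 s6) \<and> steps ?p6 s6 \<le> 40 + 60 * n + 40 * card E"
        proof (cases "clique E (nbhd E e)")
          case False
          then have "program_outcome n (result ?p6 s6) = Stop"
            using s6(4) by (simp add: program_outcome_def)
          then show ?thesis
            using ED.stop2[OF spider s3(2) clique e False] s6(4) False by simp
        next
          case clique': True
          define s7 where "s7 = result test_pair s6"
          note tp = test_pair_spec[OF s6(1), folded s7_def, unfolded s6(2,3), OF d \<open>e < n\<close>]
          have s7: "ready s7" "reg s7 ''d'' = d" "reg s7 ''e'' = e"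
            using ready_agree[OF tp(2) s6(1)] agree_reg[OF tp(2)] s6(2,3) by simp_all
          have "?ED (result ?p7 s7) \<and> steps ?p7 s7 \<le> 20 + 12 * n"
          proof (cases "efficient_dominating_set {..<n} E {d, e}")
            case True
            have b: "bval ?b3 t \<longleftrightarrow> reg t ''v'' = d \<or> reg t ''v'' = e"
              if t: "agree {''v'', ''status''} {''out''} s7 t" for t
              using agree_reg[OF t, of "''d''"] agree_reg[OF t, of "''e''"] s7(2,3) by simp
            have "{v. v < n \<and> (v = d \<or> v = e)} = {d, e}" using d \<open>e < n\<close> by auto
            then have "program_outcome n (result ?p7 s7) = Output {d, e}"
              using output_set_spec(1)[OF s7(1), of ?b3 "\<lambda>v. v = d \<or> v = e", OF b] True tp(1) by simp
            moreover have "steps (output_set ?b3) s7 \<le> 5 + 12 * n"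
              using output_set_spec(2)[OF s7(1), of ?b3 "\<lambda>v. v = d \<or> v = e", OF b] by simp
            ultimately show ?thesis
              using ED.found[OF spider s3(2) clique e clique' True] True tp(1) by simp
          next
            case False
            then have "program_outcome n (result ?p7 s7) = No_ED"
              using tp(1) by (simp add: program_outcome_def)
            then show ?thesis
              using ED.not_found[OF spider s3(2) clique e clique' False] False tp(1) by simp
          qed
          moreover have "result ?p6 s6 = result ?p7 s7"
            "steps ?p6 s6 = 4 + (steps test_pair s6 + steps ?p7 s7)"
            using s6(4) clique' by (simp_all add: s7_def)
          ultimately show ?thesis using tp(3) by simp
        qed
        moreover have "result ?p5 s5 = result ?p6 s6"
          "steps ?p5 s5 = 4 + (steps (test_clique ''e'') s5 + steps ?p6 s6)"
          using False by (simp_all add: s6_def)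
        ultimately show ?thesis using s6(5) by simp
      qed
      moreover have "result ?p4 s4 = result ?p5 s5"
        "steps ?p4 s4 = 4 + (steps choose_second s4 + steps ?p5 s5)"
        using s4(3) clique by (simp_all add: s5_def)
      ultimately show ?thesis using cs(4) by simp
    qed
    moreover have "result ?p3 s2 = result ?p4 s4"
      "steps ?p3 s2 = 4 + (steps choose_first s2 + (steps (test_clique ''d'') s3 + steps ?p4 s4))"
      using s2(3) spider by (simp_all add: s3_def s4_def)
    ultimately show ?thesis using s3(3) s4(5) by simp
  qed
  then show "?ED (result ED_program s)" "steps ED_program s \<le> 200 + 300 * n + 150 * card E"
    using res s1(2) s2(2) by simp_all
qed

end

theorem theorem3:
  shows "(\<forall>(V :: 'a set) E.
            fin_simple_graph V E \<and> prime_graph V E \<and> P5_free V E \<longrightarrow>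
              (\<exists>r. ED V E r) \<and> (\<forall>r. ED V E r \<longrightarrow> correct_outcome V E r)) \<and>
         (\<exists>c :: nat. \<forall>n (E :: nat set set) s s' t.
            fin_simple_graph {..<n} E \<and> prime_graph {..<n} E \<and> P5_free {..<n} E \<and>
            adjacency_lists n E s \<and> exec ED_program s = (s', t) \<longrightarrow>
              ED {..<n} E (program_outcome n s') \<and>
              correct_outcome {..<n} E (program_outcome n s') \<and>
              (n > 0 \<longrightarrow> t \<le> c * (n + card E)))"
proof (intro conjI allI exI[of _ "500::nat"] impI; (elim conjE)?)
  fix V :: "'a set" and E
  assume G: "fin_simple_graph V E" "prime_graph V E" "P5_free V E"
  interpret simple_graph V E by unfold_locales fact
  show "\<exists>r. ED V E r" by (rule ED_total)
  show "correct_outcome V E r" if "ED V E r" for r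
    using ED_correct[OF G that] .
next
  fix n and E :: "nat set set" and s s' t
  assume G: "fin_simple_graph {..<n} E" "prime_graph {..<n} E" "P5_free {..<n} E"
    and s: "adjacency_lists n E s" and run: "exec ED_program s = (s', t)"
  interpret graph_input n E "arr s ''off''" "arr s ''adj''"
    using G s by unfold_locales (auto simp: adjacency_lists_def)
  have "represents s" using s by (simp add: represents_def adjacency_lists_def)
  note spec = ED_program_spec[OF this, unfolded result_def steps_def run fst_conv snd_conv]
  show "ED {..<n} E (program_outcome n s')" by (rule spec(1))
  then show "correct_outcome {..<n} E (program_outcome n s')" by (rule ED_correct[OF G])
  \<comment> \<open>For \<open>n > 0\<close> the constant \<open>200\<close> is at most
    \<open>200 * n\<close>, which together with \<open>300 * n\<close> gives the factor
    \<open>500\<close>.\<close>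
  show "t \<le> 500 * (n + card E)" if "n > 0" using spec(2) that by simp
qed

end
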